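(* Suppose $\frac{\bar{\beta}}{\underline{\lambda}}\frac{1}{\sigma} < \frac{1}{\bar{\lambda}}-L-\frac{1}{\sigma}\frac{\bar{\beta}}{\underline{\lambda}}$, and fix $M$ with $$\frac{\bar{\beta}}{\underline{\lambda}}\frac{1}{\sigma}\le M\le\frac{1}{\bar{\lambda}}-L-\frac{1}{\sigma}\frac{\bar{\beta}}{\underline{\lambda}}.$$ Let $\{x^k\}_{k\in\mathbb{N}}$ be a sequence generated from $x^0$ by the algorithm iBPG. Assume that $\nabla h$ and $\nabla f$ are Lipschitz continuous on every bounded subset of $\mathbb{R}^d$, and that $\nabla^2 h$ exists and $\|\nabla^2 h\|$ is bounded above on every bounded subset of $\mathbb{R}^d$. Assume also that the function $H_M:\mathbb{R}^{2d}\to(-\infty,+\infty]$, $H_M(x,y):=\Psi(x)+M D_h(x,y)$, satisfies the Kurdyka--Łojasiewicz property at some limit point $\tilde z=(\tilde x,\tilde x)\in\mathbb{R}^{2d}$ of the sequence $\{(x^k,x^{k-1})\}_{k\in\mathbb{N}}$. Then: (i) The sequence $\{x^k\}_{k\in\mathbb{N}}$ has finite length, i.e. $\sum_{k=1}^{\infty}\|x^k-x^{k-1}\|<\infty$. (ii) $x^k\to\tilde x$ as $k\to\infty$, and $\tilde x$ is a critical point of $\Psi$.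
   Context: Setting. Let $f,g:\mathbb{R}^d\to(-\infty,+\infty]$, $\Psi:=f+g$, and $L>0$. Standing assumptions: (A-i) $h:\mathbb{R}^d\to(-\infty,+\infty]$ is a kernel generating distance associated with $S=\mathbb{R}^d$, i.e. $h$ is proper, lower semicontinuous and convex, $\text{dom}\,h\subset\overline{S}$, $\text{dom}\,\partial h=S$, and $h$ is $C^1$ on $\text{int}\,\text{dom}\,h = S=\mathbb{R}^d$. Its Bregman distance is $D_h(x,y):=h(x)-h(y)-\langle\nabla h(y),x-y\rangle$. (A-ii) $f$ is $C^1$, $\text{dom}\,h\subset\text{dom}\,f$, and $(f,h)$ is $L$-smooth adaptable on $S=\mathbb{R}^d$, i.e. $Lh-f$ and $Lh+f$ are convex on $S$. ($f$ and $g$ need not be convex.) (A-iii) $g$ is proper and lower semicontinuous. (A-iv) $\inf\{\Psi(u):u\in\mathbb{R}^d\}>-\infty$. (B) $\Psi$ is supercoercive: $\lim_{\|u\|\to\infty}\Psi(u)/\|u\|=\infty$. (C) $h$ is $\sigma$-strongly convex on $\mathbb{R}^d$, $\sigma>0$. Algorithm iBPG. Given $x^0=x^{-1}\in\text{int}\,\text{dom}\,h$ and parameters $0<\lambda_k\le 1/L$, $0\le\beta_k<1$ for $k\in\mathbb{N}=\{0,1,2,\dots\}$, for $k=0,1,2,\dots$ choose $$x^{k+1}\in\arg\min_{x\in\mathbb{R}^d}\left\{\lambda_k g(x)+\left\langle x,\lambda_k\nabla f(x^k)-\beta_k(x^k-x^{k-1})\right\rangle+D_h(x,x^k)\right\}.$$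 Notation. $\bar{\beta}:=\sup_{k\in\mathbb{N}}\beta_k$, $\bar{\lambda}:=\sup_{k\in\mathbb{N}}\lambda_k$, $\underline{\lambda}:=\inf_{k\in\mathbb{N}}\lambda_k$, and it is assumed throughout that $\underline{\lambda}>0$. Subdifferentials. The Fréchet subdifferential $\hat\partial F(\bar x)$ of $F$ at $\bar x\in\text{dom}\,F$ is the set of $v$ with $\liminf_{x\to\bar x,\,x\ne\bar x}\frac{F(x)-F(\bar x)-\langle v,x-\bar x\rangle}{\|x-\bar x\|}\ge 0$. The limiting subdifferential $\partial F(\bar x)$ at $\bar x\in\text{dom}\,F$ is the set of $v$ for which there exist $x^n\to\bar x$ with $F(x^n)\to F(\bar x)$ and $v^n\in\hat\partial F(x^n)$ with $v^n\to v$. Both are empty for $\bar x\notin\text{dom}\,F$. A critical point of $\Psi$ is a point $x$ with $0\in\partial\Psi(x)$, equivalently $0\in\nabla f(x)+\partial g(x)$. Kurdyka--Łojasiewicz (KL) property. An extended real valued function $F:\mathbb{R}^n\to(-\infty,+\infty]$ has the KL property at $\bar z\in\text{dom}\,\partial F$ if there exist $\eta\in(0,\infty]$, a neighborhood $U$ of $\bar z$, and a continuous concave function $\psi:[0,\eta)\to\mathbb{R}_+$ with $\psi(0)=0$, $\psi\in C^1(0,\eta)$, $\psi'(s)>0$ for all $s\in(0,\eta)$, such that for all $z\in U$ with $F(\bar z)<F(z)<F(\bar z)+\eta$ one has $\psi'(F(z)-F(\bar z))\,\text{dist}(0,\partial F(z))\ge 1$, where $\text{dist}(x,\mathcal{S})=\inf_{y\in\mathcal{S}}\|x-y\|$.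 *)

theory Defs
  imports "HOL-Analysis.Analysis"
begin

section \<open>Extended real valued functions\<close>

definition edom :: "('a \<Rightarrow> ereal) \<Rightarrow> 'a set" where
  "edom F = {x. F x < \<infinity>}"

definition proper :: "('a \<Rightarrow> ereal) \<Rightarrow> bool" where
  "proper F \<longleftrightarrow> (\<forall>x. F x \<noteq> -\<infinity>) \<and> edom F \<noteq> {}"

text \<open>The filter \<open>at x\<close> is punctured; this agrees with the lower limit over full neighbourhoods
  in the inequality below.\<close>
definition lsc :: "('a::topological_space \<Rightarrow> ereal) \<Rightarrow> bool" where
  "lsc F \<longleftrightarrow> (\<forall>x. F x \<le> Liminf (at x) F)"

definition econvex :: "('a::real_vector \<Rightarrow> ereal) \<Rightarrow> bool" where
  "econvex F \<longleftrightarrow> (\<forall>x y. \<forall>t\<in>{0..1}.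
     F ((1 - t) *\<^sub>R x + t *\<^sub>R y) \<le> ereal (1 - t) * F x + ereal t * F y)"

definition strongly_econvex :: "real \<Rightarrow> ('a::real_normed_vector \<Rightarrow> ereal) \<Rightarrow> bool" where
  "strongly_econvex \<sigma> F \<longleftrightarrow> (\<forall>x y. \<forall>t\<in>{0..1}.
     F ((1 - t) *\<^sub>R x + t *\<^sub>R y) + ereal (\<sigma> / 2 * t * (1 - t) * (norm (x - y))\<^sup>2)
       \<le> ereal (1 - t) * F x + ereal t * F y)"

definition supercoercive :: "('a::real_normed_vector \<Rightarrow> ereal) \<Rightarrow> bool" where
  "supercoercive F \<longleftrightarrow> ((\<lambda>u. F u / ereal (norm u)) \<longlongrightarrow> \<infinity>) at_infinity"

text \<open>Derivatives are those of the real part \<open>real_of_ereal \<circ> F\<close>; they are only meant at interior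
  points of the effective domain, where the real part coincides with \<open>F\<close>.\<close>
definition grad :: "('a::real_inner \<Rightarrow> ereal) \<Rightarrow> 'a \<Rightarrow> 'a" where
  "grad F x = (THE D. GDERIV (\<lambda>y. real_of_ereal (F y)) x :> D)"

definition C1_on :: "('a::real_inner \<Rightarrow> ereal) \<Rightarrow> 'a set \<Rightarrow> bool" where
  "C1_on F S \<longleftrightarrow> S \<subseteq> interior (edom F) \<and>
     (\<forall>x\<in>S. \<exists>D. GDERIV (\<lambda>y. real_of_ereal (F y)) x :> D) \<and> continuous_on S (grad F)"

definition hessian :: "('a::real_inner \<Rightarrow> ereal) \<Rightarrow> 'a \<Rightarrow> 'a \<Rightarrow> 'a" where
  "hessian F x = frechet_derivative (grad F) (at x)"


section \<open>Subdifferentials and critical points\<close>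

definition frechet_subdiff :: "('a::real_inner \<Rightarrow> ereal) \<Rightarrow> 'a \<Rightarrow> 'a set" where
  "frechet_subdiff F x = {v. x \<in> edom F \<and>
     0 \<le> Liminf (at x) (\<lambda>y. (F y - F x - ereal (v \<bullet> (y - x))) / ereal (norm (y - x)))}"

definition limiting_subdiff :: "('a::real_inner \<Rightarrow> ereal) \<Rightarrow> 'a \<Rightarrow> 'a set" where
  "limiting_subdiff F x = {v. x \<in> edom F \<and>
     (\<exists>xs vs. xs \<longlonglongrightarrow> x \<and> (\<lambda>n. F (xs n)) \<longlonglongrightarrow> F x \<and>
        (\<forall>n. vs n \<in> frechet_subdiff F (xs n)) \<and> vs \<longlonglongrightarrow> v)}"

definition critical_point :: "('a::real_inner \<Rightarrow> ereal) \<Rightarrow> 'a \<Rightarrow> bool" where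
  "critical_point F x \<longleftrightarrow> 0 \<in> limiting_subdiff F x"


section \<open>The Kurdyka--Lojasiewicz property\<close>

text \<open>The distance from the origin is taken in the extended reals, so that it is \<open>\<infinity>\<close> for
  an empty subdifferential (\<open>infdist\<close> would give 0).\<close>
definition dist0 :: "'a::real_normed_vector set \<Rightarrow> ereal" where
  "dist0 A = (INF v\<in>A. ereal (norm v))"

definition KL_desingularizing :: "ereal \<Rightarrow> (real \<Rightarrow> real) \<Rightarrow> bool" where
  "KL_desingularizing \<eta> \<psi> \<longleftrightarrow>
     continuous_on {s. 0 \<le> s \<and> ereal s < \<eta>} \<psi> \<and>
     concave_on {s. 0 \<le> s \<and> ereal s < \<eta>} \<psi> \<and>
     (\<forall>s. 0 \<le> s \<and> ereal s < \<eta> \<longrightarrow> 0 \<le> \<psi> s) \<and>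
     \<psi> 0 = 0 \<and>
     (\<forall>s. 0 < s \<and> ereal s < \<eta> \<longrightarrow> \<psi> field_differentiable (at s) \<and> 0 < deriv \<psi> s) \<and>
     continuous_on {s. 0 < s \<and> ereal s < \<eta>} (deriv \<psi>)"

definition KL_property_at :: "('a::real_inner \<Rightarrow> ereal) \<Rightarrow> 'a \<Rightarrow> bool" where
  "KL_property_at F zb \<longleftrightarrow> limiting_subdiff F zb \<noteq> {} \<and>
     (\<exists>\<eta> U \<psi>. 0 < \<eta> \<and> open U \<and> zb \<in> U \<and> KL_desingularizing \<eta> \<psi> \<and>
        (\<forall>z\<in>U. F zb < F z \<and> F z < F zb + \<eta> \<longrightarrow>
           1 \<le> ereal (deriv \<psi> (real_of_ereal (F z - F zb))) * dist0 (limiting_subdiff F z)))"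


section \<open>Bregman distances and the inertial Bregman proximal gradient algorithm\<close>

definition kernel_generating_distance :: "'a::euclidean_space set \<Rightarrow> ('a \<Rightarrow> ereal) \<Rightarrow> bool" where
  "kernel_generating_distance S h \<longleftrightarrow>
     proper h \<and> lsc h \<and> econvex h \<and> edom h \<subseteq> closure S \<and>
     {x. limiting_subdiff h x \<noteq> {}} = S \<and> interior (edom h) = S \<and> C1_on h S"

definition bregman :: "('a::real_inner \<Rightarrow> ereal) \<Rightarrow> 'a \<Rightarrow> 'a \<Rightarrow> ereal" where
  "bregman h x y = h x - h y - ereal (grad h y \<bullet> (x - y))"

text \<open>To be used for \<open>S\<close> contained in the effective domains of \<open>f\<close> and \<open>h\<close>.\<close>
definition smooth_adaptable ::
  "real \<Rightarrow> 'a::euclidean_space set \<Rightarrow> ('a \<Rightarrow> ereal) \<Rightarrow> ('a \<Rightarrow> ereal) \<Rightarrow> bool" where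
  "smooth_adaptable L S f h \<longleftrightarrow>
     convex_on S (\<lambda>x. L * real_of_ereal (h x) - real_of_ereal (f x)) \<and>
     convex_on S (\<lambda>x. L * real_of_ereal (h x) + real_of_ereal (f x))"

text \<open>Truncated subtraction in \<open>x (k - 1)\<close> encodes the initialisation convention that the
  iterate with index -1 equals \<open>x 0\<close>.\<close>
definition iBPG_sequence ::
  "('a::euclidean_space \<Rightarrow> ereal) \<Rightarrow> ('a \<Rightarrow> ereal) \<Rightarrow> ('a \<Rightarrow> ereal) \<Rightarrow>
     (nat \<Rightarrow> real) \<Rightarrow> (nat \<Rightarrow> real) \<Rightarrow> (nat \<Rightarrow> 'a) \<Rightarrow> bool" where
  "iBPG_sequence f g h lam \<beta> x \<longleftrightarrow>
     x 0 \<in> interior (edom h) \<and>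
     (\<forall>k. is_arg_min
        (\<lambda>u. ereal (lam k) * g u
             + ereal (u \<bullet> (lam k *\<^sub>R grad f (x k) - \<beta> k *\<^sub>R (x k - x (k - 1))))
             + bregman h u (x k))
        (\<lambda>u. True) (x (Suc k)))"

definition H_fun ::
  "('a::real_inner \<Rightarrow> ereal) \<Rightarrow> ('a \<Rightarrow> ereal) \<Rightarrow> real \<Rightarrow> 'a \<times> 'a \<Rightarrow> ereal" where
  "H_fun \<Psi> h M = (\<lambda>(x, y). \<Psi> x + ereal M * bregman h x y)"

text \<open>Limit points of a sequence are subsequential limits, not accumulation points of its range.\<close>
definition limit_point_of :: "(nat \<Rightarrow> 'a::topological_space) \<Rightarrow> 'a \<Rightarrow> bool" where
  "limit_point_of s z \<longleftrightarrow> (\<exists>r. strict_mono r \<and> (s \<circ> r) \<longlonglongrightarrow> z)"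

end

theory Submission
  imports Defs
begin

text \<open>
  Comparing \<open>x\<^sup>k\<^sup>+\<^sup>1\<close> with \<open>x\<^sup>k\<close> in the subproblem and using the descent inequality for \<open>f\<close> shows that
  \<open>H\<^sub>M(x\<^sup>k\<^sup>+\<^sup>1, x\<^sup>k)\<close> decreases by at least a multiple of \<open>\<parallel>x\<^sup>k - x\<^sup>k\<^sup>-\<^sup>1\<parallel>\<^sup>2\<close> or of
  \<open>\<parallel>x\<^sup>k\<^sup>+\<^sup>1 - x\<^sup>k\<parallel>\<^sup>2\<close>; supercoercivity then bounds the iterates. Minimality also says that \<open>g\<close> has a smooth
  minorant touching it at \<open>x\<^sup>k\<^sup>+\<^sup>1\<close>. Its gradient gives Frechet subgradients of \<open>\<Psi>\<close> and \<open>H\<^sub>M\<close> without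
  any subdifferential calculus, and local Lipschitz continuity bounds them by a multiple of
  \<open>\<parallel>x\<^sup>k\<^sup>+\<^sup>1 - x\<^sup>k\<parallel> + \<parallel>x\<^sup>k - x\<^sup>k\<^sup>-\<^sup>1\<parallel>\<close>. Combining both estimates with concavity of the desingularizing function
  turns the KL inequality into a telescoping bound on the lengths. As this inequality is available only
  near \<open>(xt, xt)\<close>, an induction keeps the iterates in a ball from some index on.
\<close>

section \<open>Desingularization\<close>

text \<open>The graph of a concave function lies below its tangent at \<open>a\<close>. The
  derivative is taken at an interior point only, while \<open>b\<close> may be the endpoint
  0.\<close>

lemma deriv_concave_gap:
  assumes KL: "KL_desingularizing \<eta> \<psi>" and "0 < a" "ereal a < \<eta>" "0 \<le> b" "b \<le> a"
  shows "deriv \<psi> a * (a - b) \<le> \<psi> a - \<psi> b"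
proof -
  let ?A = "{s. 0 \<le> s \<and> ereal s < \<eta>}"
  have int: "a \<in> interior ?A"
  proof (rule interiorI)
    have "{s. 0 < s \<and> ereal s < \<eta>} = {0<..} \<inter> (ereal -` {..<\<eta>})" by auto
    moreover have "open (ereal -` {..<\<eta>})"
      by (rule open_vimage[OF open_lessThan continuous_on_ereal[OF continuous_on_id]])
    ultimately show "open {s. 0 < s \<and> ereal s < \<eta>}"
      by (simp only: open_Int open_greaterThan)
  qed (use assms in auto)
  have less: "ereal s < \<eta>" if "s \<le> t" "ereal t < \<eta>" for s t
    using that by (metis ereal_less_eq(3) le_less_trans)
  then have bA: "b \<in> ?A" using assms by auto
  have "is_interval ?A"
    unfolding is_interval_1 using less by auto
  then have "connected ?A" by (rule is_interval_connected)
  moreover have "convex_on ?A (\<lambda>s. - \<psi> s)" using KL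
    by (simp add: KL_desingularizing_def concave_on_def)
  moreover have "\<psi> field_differentiable (at a)"
    using KL assms by (simp add: KL_desingularizing_def)
  then have "(\<psi> has_real_derivative deriv \<psi> a) (at a)"
    by (simp only: DERIV_deriv_iff_field_differentiable)
  then have "((\<lambda>s. - \<psi> s) has_real_derivative - deriv \<psi> a) (at a within ?A)"
    by (rule has_field_derivative_at_within[OF DERIV_minus])
  ultimately have "- \<psi> b - - \<psi> a \<ge> - deriv \<psi> a * (b - a)"
    using int bA by (intro convex_on_imp_above_tangent[where A = ?A])
  then show ?thesis by (simp add: algebra_simps)
qed

text \<open>For the algorithm, \<open>e = 1\<close> is needed when \<open>M\<close> equals its lower bound: the decrease then only controls
  the newer of the two increments.\<close>
lemma KL_finite_length:
  fixes x :: "nat \<Rightarrow> 'a::real_normed_vector" and E :: "nat \<Rightarrow> real"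
  defines "d \<equiv> \<lambda>k. norm (x (Suc k) - x k)"
  assumes "0 < m" "0 \<le> C" "0 < \<rho>" "0 < \<eta>" "e \<le> 1"
    and E_lim: "E \<longlonglongrightarrow> E'"
    and decrease: "\<And>k. m * (d (k + e))\<^sup>2 \<le> E k - E (Suc k)"
    and \<psi>: "KL_desingularizing \<eta> \<psi>"
    and KL: "\<And>k. norm (x (Suc k) - xt) < \<rho> \<Longrightarrow> norm (x (k + 2) - xt) < \<rho> \<Longrightarrow>
        E' < E (Suc k) \<Longrightarrow> ereal (E (Suc k) - E') < \<eta> \<Longrightarrow>
        1 \<le> deriv \<psi> (E (Suc k) - E') * (C * (d (Suc k) + d k))"
    and r: "strict_mono r" "(x \<circ> r) \<longlonglongrightarrow> xt"
  shows "summable d"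
proof -
  have d_nn: "0 \<le> d k" for k by (simp add: d_def)
  have "0 \<le> E k - E (Suc k)" for k
    using decrease[of k] \<open>0 < m\<close> by (smt (verit) mult_nonneg_nonneg zero_le_power2)
  then have dec: "decseq E" by (intro decseq_SucI) (simp add: algebra_simps)
  then have E_ge: "E' \<le> E k" for k using E_lim by (rule decseq_ge)
  show ?thesis
  proof (cases "\<exists>k. E k = E'")
    \<comment> \<open>At the limit value the KL inequality says nothing. There \<open>E\<close>
      stays constant, and the decrease condition alone makes the increments vanish.\<close>
    case True
    then obtain k0 where "E k0 = E'" by blast
    then have E_const: "E k = E'" if "k \<ge> k0" for k
      using E_ge[of k] dec that by (metis antisym decseqD)
    have "d (k + (k0 + e)) = 0" for k
    proof -
      have "m * (d (k + k0 + e))\<^sup>2 \<le> 0" using decrease[of "k + k0"] by (simp add: E_const)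
      then show ?thesis using \<open>0 < m\<close> by (simp add: mult_le_0_iff add.assoc)
    qed
    then have "summable (\<lambda>k. d (k + (k0 + e)))" by simp
    then show ?thesis by (simp only: summable_iff_shift)
  next
    case False
    then have E_gt: "E' < E k" for k using E_ge[of k] by (metis le_neq_trans)
    define c where "c = C / m"
    have c: "0 \<le> c" using assms by (simp add: c_def)
    define \<phi> where "\<phi> k = \<psi> (E k - E')" for k
    have gap0: "(\<lambda>k. E k - E') \<longlonglongrightarrow> 0" using E_lim by (simp add: LIM_zero)
    have "(\<lambda>k. ereal (E k - E')) \<longlonglongrightarrow> ereal 0" using gap0 by (rule tendsto_ereal)
    then have ev_\<eta>: "\<forall>\<^sub>F k in sequentially. ereal (E k - E') < \<eta>"
      by (rule order_tendstoD) (use \<open>0 < \<eta>\<close> in \<open>simp add: zero_ereal_def\<close>)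
    have \<psi>_cont: "continuous_on {s. 0 \<le> s \<and> ereal s < \<eta>} \<psi>" and "\<psi> 0 = 0"
      and \<psi>_nn: "\<And>s. 0 \<le> s \<Longrightarrow> ereal s < \<eta> \<Longrightarrow> 0 \<le> \<psi> s"
      using \<psi> by (auto simp: KL_desingularizing_def)
    have "\<phi> \<longlonglongrightarrow> \<psi> 0" unfolding \<phi>_def
      by (rule continuous_on_tendsto_compose[OF \<psi>_cont gap0])
         (use ev_\<eta> \<open>0 < \<eta>\<close> E_ge in \<open>auto elim!: eventually_mono simp: zero_ereal_def\<close>)
    then have "(\<lambda>k. c * \<phi> (Suc k)) \<longlonglongrightarrow> c * 0"
      unfolding \<open>\<psi> 0 = 0\<close> by (intro tendsto_intros LIMSEQ_Suc)
    then have ev_\<phi>: "\<forall>\<^sub>F k in sequentially. c * \<phi> (Suc k) < \<rho> / 16"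
      using \<open>0 < \<rho>\<close> by (intro order_tendstoD) auto
    have "(\<lambda>k. E k - E (Suc k)) \<longlonglongrightarrow> E' - E'"
      by (intro tendsto_intros E_lim LIMSEQ_Suc)
    then have "(\<lambda>k. (E k - E (Suc k)) / m) \<longlonglongrightarrow> 0 / m"
      using \<open>0 < m\<close> by (intro tendsto_divide) auto
    moreover have "(d (k + e))\<^sup>2 \<le> (E k - E (Suc k)) / m" for k
      using decrease[of k] \<open>0 < m\<close> by (simp add: field_simps)
    ultimately have "(\<lambda>k. (d (k + e))\<^sup>2) \<longlonglongrightarrow> 0"
      by (intro tendsto_sandwich[of "\<lambda>_. 0" "\<lambda>k. (d (k + e))\<^sup>2" sequentially "\<lambda>k. (E k - E (Suc k)) / m"])
        (simp_all add: always_eventually)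
    then have "(\<lambda>k. sqrt ((d (k + e))\<^sup>2)) \<longlonglongrightarrow> sqrt 0" by (rule tendsto_real_sqrt)
    then have "d \<longlonglongrightarrow> 0" using d_nn by (simp add: LIMSEQ_offset)
    then have ev_d: "\<forall>\<^sub>F k in sequentially. d k < \<rho> / 16"
      using \<open>0 < \<rho>\<close> by (intro order_tendstoD) auto
    \<comment> \<open>The thresholds are matched to the ball: a start within
      \<open>\<rho> / 4\<close>, a path of length at most \<open>3 * \<rho> / 8\<close> and one
      further increment below \<open>\<rho> / 16\<close> together stay below
      \<open>\<rho>\<close>.\<close>
    obtain N0 where N0: "\<And>k. k \<ge> N0 \<Longrightarrow>
        ereal (E k - E') < \<eta> \<and> c * \<phi> (Suc k) < \<rho> / 16 \<and> d k < \<rho> / 16"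
      using eventually_conj[OF ev_\<eta> eventually_conj[OF ev_\<phi> ev_d]]
      by (auto simp: eventually_sequentially)
    have "\<forall>\<^sub>F j in sequentially. dist ((x \<circ> r) j) xt < \<rho> / 4"
      by (rule tendstoD[OF r(2)]) (use \<open>0 < \<rho>\<close> in simp)
    then have "\<forall>\<^sub>F j in sequentially. dist ((x \<circ> r) j) xt < \<rho> / 4 \<and> j \<ge> N0"
      using eventually_ge_at_top by (rule eventually_conj)
    then obtain j where "j \<ge> N0" "dist ((x \<circ> r) j) xt < \<rho> / 4"
      by (blast dest: eventually_happens'[OF sequentially_bot])
    define N where "N = r j"
    have "N \<ge> N0" using \<open>j \<ge> N0\<close> r(1) by (metis N_def le_trans seq_suble)
    have xN: "norm (x N - xt) < \<rho> / 4"
      using \<open>dist ((x \<circ> r) j) xt < \<rho> / 4\<close> by (simp add: N_def dist_norm)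
    have small: "ereal (E k - E') < \<eta>" "c * \<phi> (Suc k) < \<rho> / 16" "d k < \<rho> / 16" if "k \<ge> N" for k
      using N0[of k] that \<open>N \<ge> N0\<close> by auto
    \<comment> \<open>With \<open>?s\<close> the sum of two increments and \<open>?f\<close> the
      drop of \<open>\<phi>\<close>, KL and concavity give d^2 <= c * ?s * ?f. Splitting this as 4 *
      (?s / 4) * (c * ?f) in the arithmetic-geometric mean inequality leaves each older increment
      the weight 1/4. The total weight 1/2 can be absorbed after summation.\<close>
    have step: "d (Suc k + e) \<le> (d (Suc k) + d k) / 4 + c * (\<phi> (Suc k) - \<phi> (k + 2))"
      if "k \<ge> N" "norm (x (Suc k) - xt) < \<rho>" "norm (x (k + 2) - xt) < \<rho>" for k
    proof -
      let ?s = "d (Suc k) + d k" and ?p = "deriv \<psi> (E (Suc k) - E')"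
      let ?e = "E (Suc k) - E (k + 2)" and ?f = "\<phi> (Suc k) - \<phi> (k + 2)"
      have le1: "1 \<le> ?p * (C * ?s)"
        using that E_gt small[of "Suc k"] by (intro KL) auto
      have Ele: "E (k + 2) \<le> E (Suc k)" using dec by (auto intro: decseqD)
      have "?p * ((E (Suc k) - E') - (E (k + 2) - E')) \<le> ?f" unfolding \<phi>_def
        using small[of "Suc k"] that E_gt[of "Suc k"] E_ge[of "k + 2"] Ele
        by (intro deriv_concave_gap[OF \<psi>]) auto
      then have pf: "?p * ?e \<le> ?f" by simp
      have sC: "0 \<le> C * ?s" using d_nn \<open>0 \<le> C\<close> by simp
      have "m * (d (Suc k + e))\<^sup>2 \<le> ?e * 1" using decrease[of "Suc k"] by simp
      also have "\<dots> \<le> ?e * (?p * (C * ?s))" using le1 Ele by (intro mult_left_mono) auto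
      also have "\<dots> = (?p * ?e) * (C * ?s)" by simp
      also have "\<dots> \<le> ?f * (C * ?s)" using pf sC by (rule mult_right_mono)
      finally have sq: "(d (Suc k + e))\<^sup>2 \<le> 4 * (?s / 4) * (c * ?f)"
        using \<open>0 < m\<close> by (simp add: c_def field_simps)
      have "0 < ?p" using \<psi> E_gt[of "Suc k"] small(1)[of "Suc k"] that
        by (simp add: KL_desingularizing_def)
      then have "0 \<le> ?f" using pf Ele by (smt (verit) mult_nonneg_nonneg)
      then have nn: "0 \<le> ?s / 4 + c * ?f" using c d_nn by simp
      have "4 * a * b \<le> (a + b)\<^sup>2" for a b :: real
        using sum_squares_bound[of a b] by (simp add: power2_sum)
      then have "(d (Suc k + e))\<^sup>2 \<le> (?s / 4 + c * ?f)\<^sup>2" using sq by (rule order_trans[rotated])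
      then show ?thesis using nn by (rule power2_le_imp_le)
    qed
    define A where "A n = (\<Sum>i<n. d (N + i))" for n
    have A_mono: "A i \<le> A j" if "i \<le> j" for i j
      unfolding A_def using that d_nn by (intro sum_mono2) auto
    have "A (1 + e) \<le> A 2" using \<open>e \<le> 1\<close> by (intro A_mono) auto
    also have "\<dots> = d N + d (Suc N)" by (simp add: A_def numeral_2_eq_2)
    also have "\<dots> < \<rho> / 8" using small(3)[of N] small(3)[of "Suc N"] by simp
    finally have A1: "A (1 + e) < \<rho> / 8" .
    have A_bound: "A (Suc n) \<le> 3 * \<rho> / 8"
      if ball: "\<And>i. i \<le> Suc n \<Longrightarrow> norm (x (N + i) - xt) < \<rho>" for n
    proof -
      \<comment> \<open>The first \<open>1 + e\<close> increments are split off because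
        \<open>step\<close>, used from \<open>k = N\<close> on, starts with the increment of index
        \<open>N + 1 + e\<close>.\<close>
      have "A (n + (1 + e)) = A (1 + e) + (\<Sum>i<n. d (Suc (N + i) + e))"
        unfolding A_def by (induction n) (auto simp: algebra_simps)
      also have "(\<Sum>i<n. d (Suc (N + i) + e)) \<le>
          (\<Sum>i<n. (d (Suc (N + i)) + d (N + i)) / 4 + c * (\<phi> (Suc (N + i)) - \<phi> (N + i + 2)))"
      proof (rule sum_mono)
        fix i assume "i \<in> {..<n}"
        then have "norm (x (N + Suc i) - xt) < \<rho>" "norm (x (N + (i + 2)) - xt) < \<rho>"
          using ball[of "Suc i"] ball[of "i + 2"] by simp_all
        then show "d (Suc (N + i) + e) \<le>
            (d (Suc (N + i)) + d (N + i)) / 4 + c * (\<phi> (Suc (N + i)) - \<phi> (N + i + 2))"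
          by (intro step) (simp_all add: add.assoc)
      qed
      also have "\<dots> = ((\<Sum>i<n. d (Suc (N + i))) + A n) / 4
          + c * (\<Sum>i<n. \<phi> (Suc (N + i)) - \<phi> (Suc (N + Suc i)))"
        by (simp add: sum.distrib sum_distrib_left sum_divide_distrib A_def add_divide_distrib)
      also have "(\<Sum>i<n. \<phi> (Suc (N + i)) - \<phi> (Suc (N + Suc i))) = \<phi> (Suc N) - \<phi> (Suc (N + n))"
        by (subst sum_lessThan_telescope') simp
      also have "(\<Sum>i<n. d (Suc (N + i))) = A (Suc n) - d N"
        unfolding A_def by (subst sum.lessThan_Suc_shift) simp
      finally have "A (n + (1 + e)) \<le> A (1 + e) + ((A (Suc n) - d N + A n) / 4
          + c * (\<phi> (Suc N) - \<phi> (Suc (N + n))))" by simp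
      moreover have "A (Suc n) \<le> A (n + (1 + e))" "A n \<le> A (Suc n)" by (auto intro: A_mono)
      moreover have "0 \<le> \<phi> (Suc (N + n))" unfolding \<phi>_def
        using small(1)[of "Suc (N + n)"] E_ge[of "Suc (N + n)"] by (intro \<psi>_nn) auto
      then have "0 \<le> c * \<phi> (Suc (N + n))" using c by simp
      \<comment> \<open>Here \<open>u\<close> stands for \<open>A (Suc n)\<close>. On the right it
        occurs with weight at most 1/2, so u <= 2 * (\<rho> / 8 + \<rho> / 16).\<close>
      moreover have "u \<le> 3 * \<rho> / 8"
        if "w \<le> v + ((u - d N + t) / 4 + c * (y - z))" "u \<le> w" "t \<le> u" "0 \<le> c * z"
          "c * y < \<rho> / 16" "v < \<rho> / 8" for t u v w y z
        using that d_nn[of N] unfolding right_diff_distrib by argo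
      ultimately show ?thesis using small(2)[OF order_refl] A1 by blast
    qed
    have tri: "norm (x (N + n) - xt) \<le> norm (x N - xt) + A n" for n
    proof (induction n)
      case (Suc n)
      have "norm (x (N + Suc n) - xt) \<le> d (N + n) + norm (x (N + n) - xt)"
        unfolding d_def using norm_triangle_ineq[of "x (Suc (N + n)) - x (N + n)" "x (N + n) - xt"]
        by simp
      then show ?case using Suc by (simp add: A_def)
    qed (simp add: A_def)
    \<comment> \<open>\<open>A_bound\<close> presupposes that the iterates up to
      \<open>N + Suc n\<close> are in the ball and then bounds the length of the path to the last of
      them. The next increment is below \<open>\<rho> / 16\<close>, so the next iterate is in the
      ball as well and the induction closes.\<close>
    have ball: "\<forall>i\<le>Suc n. norm (x (N + i) - xt) < \<rho>" for n
    proof (induction n)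
      case 0
      have "A 1 = d N" by (simp add: A_def)
      then show ?case using tri[of 1] xN small(3)[of N] \<open>0 < \<rho>\<close>
        by (auto simp: le_Suc_eq)
    next
      case (Suc n)
      have "A (Suc (Suc n)) = A (Suc n) + d (N + Suc n)" by (simp add: A_def)
      then have "norm (x (N + Suc (Suc n)) - xt) < \<rho>"
        using tri[of "Suc (Suc n)"] xN small(3)[of "N + Suc n"] A_bound[of n] Suc \<open>0 < \<rho>\<close> by auto
      then show ?case using Suc by (auto simp: le_Suc_eq)
    qed
    have "A n \<le> 3 * \<rho> / 8" for n
      using A_mono[of n "Suc n"] A_bound[of n] ball[of n] by force
    then have "summable (\<lambda>i. d (N + i))"
      using d_nn by (intro summableI_nonneg_bounded[where x = "3 * \<rho> / 8"]) (auto simp: A_def)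
    then show ?thesis by (simp add: add.commute[of N] summable_iff_shift)
  qed
qed

section \<open>Gradients and subgradients\<close>

lemma GDERIV_unique:
  assumes "GDERIV F x :> D" "GDERIV F x :> D'"
  shows "D = D'"
proof -
  have "(\<lambda>d. d \<bullet> D) = (\<lambda>d. d \<bullet> D')"
    using assms unfolding gderiv_def by (rule has_derivative_unique)
  then show ?thesis by (metis vector_eq_ldot)
qed

lemma C1_on_GDERIV:
  assumes "C1_on F S" "x \<in> S"
  shows "GDERIV (\<lambda>y. real_of_ereal (F y)) x :> grad F x"
  unfolding grad_def by (rule theI') (use assms GDERIV_unique in \<open>auto simp: C1_on_def\<close>)

text \<open>Divide the inequality on the segment by \<open>t\<close> and let \<open>t\<close> tend
  to 0 from the right. The modulus \<open>\<sigma>\<close> may be 0, so that plain convexity is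
  covered too.\<close>

lemma strongly_convex_above_tangent:
  fixes \<phi> :: "'a::real_inner \<Rightarrow> real"
  assumes D: "GDERIV \<phi> w :> D"
    and conv: "\<And>t. 0 \<le> t \<Longrightarrow> t \<le> 1 \<Longrightarrow>
      \<phi> ((1 - t) *\<^sub>R w + t *\<^sub>R u) + \<sigma> / 2 * t * (1 - t) * (norm (w - u))\<^sup>2
        \<le> (1 - t) * \<phi> w + t * \<phi> u"
  shows "\<phi> w + D \<bullet> (u - w) + \<sigma> / 2 * (norm (u - w))\<^sup>2 \<le> \<phi> u"
proof -
  let ?N = "(norm (u - w))\<^sup>2"
  define \<gamma> where "\<gamma> t = \<phi> (w + t *\<^sub>R (u - w))" for t
  have "((\<lambda>t. w + t *\<^sub>R (u - w)) has_derivative (\<lambda>t. t *\<^sub>R (u - w))) (at 0)"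
    by (auto intro!: derivative_eq_intros)
  moreover have "(\<phi> has_derivative (\<lambda>d. d \<bullet> D)) (at (w + 0 *\<^sub>R (u - w)))"
    using D by (simp add: gderiv_def)
  ultimately have "(\<gamma> has_derivative (\<lambda>t. t *\<^sub>R (u - w) \<bullet> D)) (at 0)"
    unfolding \<gamma>_def by (rule has_derivative_compose)
  then have "(\<gamma> has_real_derivative (u - w) \<bullet> D) (at 0)"
    by (simp add: has_field_derivative_def mult_commute_abs)
  then have "((\<lambda>t. (\<gamma> (0 + t) - \<gamma> 0) / t) \<longlongrightarrow> (u - w) \<bullet> D) (at 0)"
    by (simp only: DERIV_def)
  then have lim1: "((\<lambda>t. (\<gamma> (0 + t) - \<gamma> 0) / t) \<longlongrightarrow> (u - w) \<bullet> D) (at_right 0)"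
    by (rule tendsto_within_subset) simp
  have lim2: "((\<lambda>t. \<phi> u - \<phi> w - \<sigma> / 2 * (1 - t) * ?N) \<longlongrightarrow> \<phi> u - \<phi> w - \<sigma> / 2 * (1 - 0) * ?N) (at_right 0)"
    by (intro tendsto_intros)
  have "\<forall>\<^sub>F t in at_right 0. (\<gamma> (0 + t) - \<gamma> 0) / t \<le> \<phi> u - \<phi> w - \<sigma> / 2 * (1 - t) * ?N"
  proof (rule eventually_at_rightI[of 0 1])
    fix t :: real assume t: "t \<in> {0<..<1}"
    have "(1 - t) *\<^sub>R w + t *\<^sub>R u = w + t *\<^sub>R (u - w)" by (simp add: algebra_simps)
    then have "\<gamma> t + \<sigma> / 2 * t * (1 - t) * ?N \<le> (1 - t) * \<phi> w + t * \<phi> u"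
      using conv[of t] t by (simp add: \<gamma>_def norm_minus_commute)
    then have "\<gamma> t - \<phi> w \<le> t * (\<phi> u - \<phi> w - \<sigma> / 2 * (1 - t) * ?N)"
      by (simp add: algebra_simps)
    then show "(\<gamma> (0 + t) - \<gamma> 0) / t \<le> \<phi> u - \<phi> w - \<sigma> / 2 * (1 - t) * ?N"
      using t by (simp add: divide_le_eq \<gamma>_def mult.commute)
  qed simp
  then have "(u - w) \<bullet> D \<le> \<phi> u - \<phi> w - \<sigma> / 2 * (1 - 0) * ?N"
    by (rule tendsto_le[OF trivial_limit_at_right_real lim2 lim1])
  then show ?thesis by (simp add: inner_commute)
qed

text \<open>The difference quotient of \<open>F\<close> dominates that of the touching function
  \<open>T\<close>, which tends to 0. This stands in for a sum rule of subdifferentials, and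
  \<open>F\<close> may be infinite away from \<open>x\<close>.\<close>

lemma frechet_subdiff_minorant:
  fixes F :: "'a::euclidean_space \<Rightarrow> ereal"
  assumes Fx: "F x = ereal (T x)" and le: "\<And>y. ereal (T y) \<le> F y" and D: "GDERIV T x :> v"
  shows "v \<in> frechet_subdiff F x"
proof -
  let ?q = "\<lambda>y. (T y - T x - v \<bullet> (y - x)) / norm (y - x)"
  have "(?q \<longlongrightarrow> 0) (at x)"
    using D unfolding gderiv_def has_derivative_def
    by (simp add: inner_commute divide_inverse_commute algebra_simps)
  then have "((\<lambda>y. ereal (?q y)) \<longlongrightarrow> ereal 0) (at x)" by (rule tendsto_ereal)
  then have "0 = Liminf (at x) (\<lambda>y. ereal (?q y))"
    unfolding zero_ereal_def by (rule lim_imp_Liminf[OF trivial_limit_at, symmetric])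
  also have "\<dots> \<le> Liminf (at x) (\<lambda>y. (F y - F x - ereal (v \<bullet> (y - x))) / ereal (norm (y - x)))"
  proof (rule Liminf_mono)
    have "ereal (?q y) \<le> (F y - F x - ereal (v \<bullet> (y - x))) / ereal (norm (y - x))" if "y \<noteq> x" for y
    proof -
      have "ereal (T y) - ereal (T x) - ereal (v \<bullet> (y - x)) \<le> F y - F x - ereal (v \<bullet> (y - x))"
        unfolding Fx by (intro ereal_minus_mono le order_refl)
      then have "(ereal (T y) - ereal (T x) - ereal (v \<bullet> (y - x))) / ereal (norm (y - x))
          \<le> (F y - F x - ereal (v \<bullet> (y - x))) / ereal (norm (y - x))"
        using that by (intro ereal_divide_right_mono) auto
      then show ?thesis using that by simp
    qed
    then show "\<forall>\<^sub>F y in at x. ereal (?q y)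
        \<le> (F y - F x - ereal (v \<bullet> (y - x))) / ereal (norm (y - x))"
      by (simp add: eventually_at_filter)
  qed
  finally show ?thesis by (simp add: frechet_subdiff_def edom_def Fx)
qed

lemma limiting_subdiffI:
  assumes "x \<in> edom F" "xs \<longlonglongrightarrow> x" "(\<lambda>n. F (xs n)) \<longlonglongrightarrow> F x"
    and "\<And>n. vs n \<in> frechet_subdiff F (xs n)" "vs \<longlonglongrightarrow> v"
  shows "v \<in> limiting_subdiff F x"
  using assms unfolding limiting_subdiff_def by blast

lemma frechet_subdiff_subset_limiting: "frechet_subdiff F x \<subseteq> limiting_subdiff F x"
proof
  fix v assume v: "v \<in> frechet_subdiff F x"
  show "v \<in> limiting_subdiff F x"
    by (rule limiting_subdiffI[where xs = "\<lambda>_. x" and vs = "\<lambda>_. v"])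
      (use v in \<open>auto simp: frechet_subdiff_def\<close>)
qed

text \<open>Pair \<open>adjoint A y\<close> with itself, move \<open>A\<close> across, apply
  Cauchy-Schwarz and cancel one factor.\<close>

lemma norm_adjoint_le:
  fixes A :: "'a::euclidean_space \<Rightarrow> 'b::euclidean_space"
  assumes "linear A"
  shows "norm (adjoint A y) \<le> onorm A * norm y"
proof -
  let ?a = "adjoint A y"
  have bl: "bounded_linear A" using assms by (simp add: linear_conv_bounded_linear)
  have "norm ?a * norm ?a = ?a \<bullet> ?a" by (simp flip: power2_eq_square add: power2_norm_eq_inner)
  also have "\<dots> = A ?a \<bullet> y" by (rule adjoint_works[OF assms])
  also have "\<dots> \<le> norm (A ?a) * norm y" by (rule norm_cauchy_schwarz)
  also have "\<dots> \<le> onorm A * norm ?a * norm y" by (intro mult_right_mono onorm[OF bl]) auto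
  finally have "norm ?a * norm ?a \<le> (onorm A * norm y) * norm ?a" by (simp add: ac_simps)
  then show ?thesis
    using onorm_pos_le[OF bl] by (cases "norm ?a = 0") (auto simp: mult_le_cancel_right)
qed

text \<open>In the second variable the derivative of \<open>h\<close> cancels against that of the
  linear factor \<open>fst z - snd z\<close>. What remains is the derivative of \<open>gh\<close>,
  whose adjoint turns it into a gradient.\<close>

lemma GDERIV_bregman:
  fixes h :: "'a::euclidean_space \<Rightarrow> real"
  assumes h: "\<And>u. GDERIV h u :> gh u" and gh: "(gh has_derivative A) (at w)"
  shows "GDERIV (\<lambda>z. h (fst z) - h (snd z) - gh (snd z) \<bullet> (fst z - snd z)) (u, w)
    :> (gh u - gh w, - adjoint A (u - w))"
proof -
  have h': "(h has_derivative (\<lambda>d. d \<bullet> gh v)) (at v)" for v using h by (simp add: gderiv_def)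
  have h1: "((\<lambda>z. h (fst z)) has_derivative (\<lambda>d. fst d \<bullet> gh u)) (at (u, w))"
    by (rule has_derivative_compose[OF has_derivative_fst[OF has_derivative_ident]]) (simp add: h')
  have h2: "((\<lambda>z. h (snd z)) has_derivative (\<lambda>d. snd d \<bullet> gh w)) (at (u, w))"
    by (rule has_derivative_compose[OF has_derivative_snd[OF has_derivative_ident]]) (simp add: h')
  have g2: "((\<lambda>z. gh (snd z)) has_derivative (\<lambda>d. A (snd d))) (at (u, w))"
    by (rule has_derivative_compose[OF has_derivative_snd[OF has_derivative_ident]]) (simp add: gh)
  have i: "((\<lambda>z. gh (snd z) \<bullet> (fst z - snd z)) has_derivative
      (\<lambda>d. gh w \<bullet> (fst d - snd d) + A (snd d) \<bullet> (u - w))) (at (u, w))"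
    by (rule has_derivative_eq_rhs[OF has_derivative_inner[OF g2 has_derivative_diff[OF
        has_derivative_fst[OF has_derivative_ident] has_derivative_snd[OF has_derivative_ident]]]]) simp
  have lin: "linear A" using gh by (rule has_derivative_linear)
  show ?thesis unfolding gderiv_def
    by (rule has_derivative_eq_rhs[OF has_derivative_diff[OF has_derivative_diff[OF h1 h2] i]])
      (auto simp: inner_prod_def adjoint_works[OF lin] inner_diff_right inner_commute algebra_simps)
qed

section \<open>Lower semicontinuity and bounded sublevel sets\<close>

lemma lsc_eventually:
  assumes "lsc F" "c < F x"
  shows "\<forall>\<^sub>F y in nhds x. c < F y"
proof -
  have "c < Liminf (at x) F" using assms by (auto simp: lsc_def intro: less_le_trans)
  then have "\<forall>\<^sub>F y in at x. c < F y" by (rule less_LiminfD)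
  \<comment> \<open>The lower limit ignores the point \<open>x\<close>; there the bound is the
    second assumption.\<close>
  then show ?thesis using assms(2) by (auto simp: eventually_at_filter elim!: eventually_mono)
qed

lemma supercoercive_bounded_sublevel:
  fixes F :: "'a::real_normed_vector \<Rightarrow> ereal"
  assumes "supercoercive F"
  shows "bounded {u. F u \<le> ereal c}"
proof -
  have "\<forall>\<^sub>F u in at_infinity. 1 < F u / ereal (norm u)"
    using assms unfolding supercoercive_def by (rule order_tendstoD) simp
  then obtain b where b: "\<And>u. b \<le> norm u \<Longrightarrow> 1 < F u / ereal (norm u)"
    by (auto simp: eventually_at_infinity)
  \<comment> \<open>Far out, \<open>F u\<close> exceeds \<open>norm u\<close>, which is impossible
    in the sublevel set once \<open>norm u\<close> is above \<open>c\<close>. The 1 keeps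
    \<open>u\<close> away from 0, so that the quotient can be cleared.\<close>
  have "norm u \<le> max 1 (max b c)" if "F u \<le> ereal c" for u
  proof (rule ccontr)
    assume "\<not> ?thesis"
    then have n: "1 < norm u" "b \<le> norm u" "c < norm u" by auto
    then have "ereal 1 < F u / ereal (norm u)" using b by (simp flip: one_ereal_def)
    moreover have "u \<noteq> 0" using n by auto
    ultimately have "ereal (norm u) < F u"
      by (cases "F u") (auto simp: field_simps)
    then have "ereal (norm u) < ereal c" using that by (rule less_le_trans)
    then show False using n by simp
  qed
  then show ?thesis by (intro boundedI[where B = "max 1 (max b c)"]) auto
qed

section \<open>The inertial Bregman iteration\<close>

definition breg :: "('a::real_inner \<Rightarrow> real) \<Rightarrow> ('a \<Rightarrow> 'a) \<Rightarrow> 'a \<Rightarrow> 'a \<Rightarrow> real" where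
  "breg h gh u w = h u - h w - gh w \<bullet> (u - w)"

text \<open>Real valued form of the setting: \<open>f\<close> and \<open>h\<close> are finite
  everywhere, and only \<open>g\<close> stays extended. Convexity is recorded through its
  consequences \<open>descent\<close> and \<open>strong\<close>. The constant \<open>b\<close>
  measures how strongly the inertial term couples consecutive Bregman distances.\<close>

locale inertial_bregman =
  fixes f h :: "'a::euclidean_space \<Rightarrow> real" and g :: "'a \<Rightarrow> ereal" and gf gh :: "'a \<Rightarrow> 'a"
    and L \<sigma> lam_inf lam_sup \<beta>_sup M :: real and lam \<beta> :: "nat \<Rightarrow> real" and x :: "nat \<Rightarrow> 'a"
  fixes b
  defines "b \<equiv> \<beta>_sup / lam_inf / \<sigma>"
  assumes f_deriv: "\<And>u. GDERIV f u :> gf u"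
    and h_deriv: "\<And>u. GDERIV h u :> gh u"
    and gf_cont: "continuous_on UNIV gf"
    and gh_diff: "\<And>u. gh differentiable (at u)"
    and descent: "\<And>u w. f u \<le> f w + gf w \<bullet> (u - w) + L * breg h gh u w"
    and strong: "\<And>u w. \<sigma> / 2 * (norm (u - w))\<^sup>2 \<le> breg h gh u w"
    and \<sigma>_pos: "\<sigma> > 0"
    and lam_inf_pos: "0 < lam_inf"
    and lam_bounds: "\<And>k. lam_inf \<le> lam k" "\<And>k. lam k \<le> lam_sup"
    and \<beta>_bounds: "\<And>k. 0 \<le> \<beta> k" "\<And>k. \<beta> k \<le> \<beta>_sup"
    and gap: "b < 1 / lam_sup - L - b"
    and M_bounds: "b \<le> M" "M \<le> 1 / lam_sup - L - b"
    and g_proper: "proper g"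
    and g_lsc: "lsc g"
    and Psi_bdd: "\<exists>c. \<forall>u. ereal c \<le> ereal (f u) + g u"
    and Psi_sublevel: "\<And>c. bounded {u. ereal (f u) + g u \<le> ereal c}"
    and argmin: "\<And>k u. ereal (lam k) * g (x (Suc k)) + ereal (x (Suc k) \<bullet>
        (lam k *\<^sub>R gf (x k) - \<beta> k *\<^sub>R (x k - x (k - 1))) + breg h gh (x (Suc k)) (x k))
      \<le> ereal (lam k) * g u + ereal (u \<bullet>
        (lam k *\<^sub>R gf (x k) - \<beta> k *\<^sub>R (x k - x (k - 1))) + breg h gh u (x k))"
    and gf_lipschitz: "\<And>B. bounded B \<Longrightarrow> \<exists>C. C-lipschitz_on B gf"
    and gh_lipschitz: "\<And>B. bounded B \<Longrightarrow> \<exists>C. C-lipschitz_on B gh"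
    and hessian_bounded: "\<And>B. bounded B \<Longrightarrow>
        \<exists>C. \<forall>u\<in>B. onorm (frechet_derivative gh (at u)) \<le> C"
begin

abbreviation D :: "'a \<Rightarrow> 'a \<Rightarrow> real" where
  "D \<equiv> breg h gh"

definition lin :: "nat \<Rightarrow> 'a" where
  "lin k = lam k *\<^sub>R gf (x k) - \<beta> k *\<^sub>R (x k - x (k - 1))"

text \<open>The index starts at \<open>Suc k\<close> because \<open>x 0\<close> may lie outside the
  domain of \<open>g\<close>. At all later iterates \<open>g\<close> is finite, by
  \<open>g_x\<close>.\<close>

definition G :: "nat \<Rightarrow> real" where
  "G k = real_of_ereal (g (x (Suc k)))"

definition d :: "nat \<Rightarrow> real" where
  "d k = norm (x (Suc k) - x k)"

definition E :: "nat \<Rightarrow> real" where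
  "E k = f (x (Suc k)) + G k + M * D (x (Suc k)) (x k)"

definition Hr :: "'a \<times> 'a \<Rightarrow> ereal" where
  "Hr z = ereal (f (fst z)) + g (fst z) + ereal (M * D (fst z) (snd z))"

lemma lam_pos: "0 < lam k"
  using lam_inf_pos lam_bounds(1)[of k] by linarith

lemma D_nonneg: "0 \<le> D u w"
  using strong[of u w] \<sigma>_pos by (smt (verit) divide_nonneg_nonneg mult_nonneg_nonneg zero_le_power2)

lemma b_nonneg: "0 \<le> b"
  using \<beta>_bounds[of 0] lam_inf_pos \<sigma>_pos by (simp add: b_def)

lemma M_nonneg: "0 \<le> M"
  using b_nonneg M_bounds(1) by linarith

lemma D_self [simp]: "D u u = 0"
  by (simp add: breg_def)

section \<open>Minimality in the subproblem and one-step descent\<close>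

lemma g_x: "g (x (Suc k)) = ereal (G k)"
proof -
  obtain u where u: "g u < \<infinity>" using g_proper by (auto simp: proper_def edom_def)
  have "g (x (Suc k)) \<noteq> \<infinity>"
  proof
    assume "g (x (Suc k)) = \<infinity>"
    then have "\<infinity> \<le> ereal (lam k) * g u + ereal (u \<bullet> lin k + D u (x k))"
      using argmin[of k u] lam_pos[of k] by (simp add: lin_def)
    then show False using u g_proper by (cases "g u") (auto simp: proper_def)
  qed
  moreover have "g (x (Suc k)) \<noteq> -\<infinity>" using g_proper by (simp add: proper_def)
  ultimately show ?thesis unfolding G_def by (cases "g (x (Suc k))") auto
qed

text \<open>Minimality of \<open>x (Suc k)\<close>, solved for \<open>g u\<close>. The left side is
  differentiable in \<open>u\<close> and agrees with \<open>g\<close> at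
  \<open>u = x (Suc k)\<close>.\<close>

lemma prox_minorant:
  "ereal (G k - ((u - x (Suc k)) \<bullet> lin k + D u (x k) - D (x (Suc k)) (x k)) / lam k) \<le> g u"
proof (cases "g u")
  case (real r)
  have "lam k * G k + (x (Suc k) \<bullet> lin k + D (x (Suc k)) (x k)) \<le> lam k * r + (u \<bullet> lin k + D u (x k))"
    using argmin[of k u] by (simp add: real g_x lin_def)
  then have "lam k * (G k - r) \<le> (u - x (Suc k)) \<bullet> lin k + D u (x k) - D (x (Suc k)) (x k)"
    by (simp add: algebra_simps)
  then have "G k - r \<le> ((u - x (Suc k)) \<bullet> lin k + D u (x k) - D (x (Suc k)) (x k)) / lam k"
    using lam_pos[of k] by (simp add: pos_le_divide_eq mult.commute)
  then show ?thesis by (simp add: real)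
qed (use g_proper in \<open>auto simp: proper_def\<close>)

text \<open>The subproblem that produces \<open>x (k + 2)\<close> is compared at
  \<open>x (Suc k)\<close>, where its Bregman term is 0. The inner product with \<open>gf\<close>
  cancels against the one in \<open>descent\<close>, which leaves the inertial term to be
  estimated.\<close>

lemma Psi_descent:
  "f (x (k + 2)) + G (Suc k) + (1 / lam_sup - L - b) * D (x (k + 2)) (x (Suc k))
    \<le> f (x (Suc k)) + G k + b * D (x (Suc k)) (x k)"
proof -
  let ?y = "x (k + 2)" and ?z = "x (Suc k)" and ?l = "lam (Suc k)" and ?\<beta> = "\<beta> (Suc k)"
  let ?D' = "D ?y ?z" and ?D = "D ?z (x k)"
  have lpos: "0 < ?l" by (rule lam_pos)
  have "G (Suc k) - ((?z - ?y) \<bullet> lin (Suc k) - ?D') / ?l \<le> G k"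
    using prox_minorant[of "Suc k" ?z] by (simp add: g_x)
  moreover have "(?z - ?y) \<bullet> lin (Suc k) = - (?l * (gf ?z \<bullet> (?y - ?z))) + ?\<beta> * ((?z - x k) \<bullet> (?y - ?z))"
    by (simp add: lin_def inner_simps inner_commute algebra_simps)
  then have "((?z - ?y) \<bullet> lin (Suc k) - ?D') / ?l =
      - (gf ?z \<bullet> (?y - ?z)) + ?\<beta> / ?l * ((?z - x k) \<bullet> (?y - ?z)) - ?D' / ?l"
    using lpos by (simp add: add_divide_distrib diff_divide_distrib)
  moreover have "f ?y \<le> f ?z + gf ?z \<bullet> (?y - ?z) + L * ?D'" by (rule descent)
  \<comment> \<open>Cauchy-Schwarz and 2ab <= a^2 + b^2 separate the two increments. Strong
    convexity turns their squares into Bregman distances, which produces the factor 1 / \<sigma> in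
    \<open>b\<close>.\<close>
  moreover have "?\<beta> / ?l * ((?z - x k) \<bullet> (?y - ?z)) \<le> b * (?D + ?D')"
  proof -
    have "(?z - x k) \<bullet> (?y - ?z) \<le> norm (?z - x k) * norm (?y - ?z)"
      by (rule norm_cauchy_schwarz)
    also have "\<dots> \<le> ((norm (?z - x k))\<^sup>2 + (norm (?y - ?z))\<^sup>2) / 2"
      using sum_squares_bound[of "norm (?z - x k)" "norm (?y - ?z)"] by simp
    also have "\<dots> \<le> (?D + ?D') / \<sigma>"
      using strong[of ?z "x k"] strong[of ?y ?z] \<sigma>_pos by (simp add: field_simps)
    finally have "?\<beta> / ?l * ((?z - x k) \<bullet> (?y - ?z)) \<le> ?\<beta> / ?l * ((?D + ?D') / \<sigma>)"
      using \<beta>_bounds(1)[of "Suc k"] lpos by (intro mult_left_mono) auto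
    also have "\<dots> \<le> \<beta>_sup / lam_inf * ((?D + ?D') / \<sigma>)"
      using \<beta>_bounds[of "Suc k"] lam_bounds(1)[of "Suc k"] lam_inf_pos \<sigma>_pos
        D_nonneg[of ?z "x k"] D_nonneg[of ?y ?z]
      by (intro mult_right_mono frac_le) auto
    finally show ?thesis by (simp add: b_def)
  qed
  moreover have "1 / lam_sup * ?D' \<le> 1 / ?l * ?D'"
    using lam_bounds(2)[of "Suc k"] lpos by (intro mult_right_mono D_nonneg frac_le) auto
  ultimately show ?thesis by (simp add: algebra_simps)
qed

section \<open>Decrease and convergence of the energy; boundedness of the iterates\<close>

lemma E_decrease:
  "(M - b) * D (x (Suc k)) (x k) + (1 / lam_sup - L - b - M) * D (x (k + 2)) (x (Suc k))
    \<le> E k - E (Suc k)"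
  using Psi_descent[of k] by (simp add: E_def algebra_simps)

text \<open>Both coefficients in \<open>E_decrease\<close> are nonnegative by
  \<open>M_bounds\<close>, and their sum is positive by \<open>gap\<close>. If the first is positive
  it controls \<open>d k\<close>, giving \<open>e = 0\<close>; otherwise \<open>M = b\<close> and
  the second controls \<open>d (Suc k)\<close>, giving \<open>e = 1\<close>.\<close>

lemma E_sufficient_decrease:
  obtains m e where "0 < m" "e \<le> (1::nat)" "\<And>k. m * (d (k + e))\<^sup>2 \<le> E k - E (Suc k)"
proof -
  have s: "c * (\<sigma> / 2) * (d k)\<^sup>2 \<le> c * D (x (Suc k)) (x k)" if "0 \<le> c" for c k
    using mult_left_mono[OF strong[of "x (Suc k)" "x k"] that] by (simp add: d_def mult.assoc)
  show ?thesis
  proof (cases "b < M")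
    case True
    have "(M - b) * (\<sigma> / 2) * (d (k + 0))\<^sup>2 \<le> E k - E (Suc k)" for k
    proof -
      have "0 \<le> (1 / lam_sup - L - b - M) * D (x (k + 2)) (x (Suc k))"
        using M_bounds by (intro mult_nonneg_nonneg D_nonneg) simp
      moreover have "(M - b) * (\<sigma> / 2) * (d k)\<^sup>2 \<le> (M - b) * D (x (Suc k)) (x k)"
        using True by (intro s) simp
      ultimately show ?thesis using E_decrease[of k] unfolding add_0_right by linarith
    qed
    then show ?thesis using True \<sigma>_pos by (intro that[of "(M - b) * (\<sigma> / 2)" 0]) auto
  next
    case False
    then have M: "M = b" using M_bounds by simp
    have "(1 / lam_sup - L - b - M) * (\<sigma> / 2) * (d (k + 1))\<^sup>2 \<le> E k - E (Suc k)" for k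
    proof -
      have "(M - b) * D (x (Suc k)) (x k) = 0" using M by simp
      moreover have "(1 / lam_sup - L - b - M) * (\<sigma> / 2) * (d (Suc k))\<^sup>2
          \<le> (1 / lam_sup - L - b - M) * D (x (k + 2)) (x (Suc k))"
        using s[of "1 / lam_sup - L - b - M" "Suc k"] M_bounds by simp
      ultimately show ?thesis using E_decrease[of k] unfolding Suc_eq_plus1[symmetric] by linarith
    qed
    then show ?thesis using gap M \<sigma>_pos
      by (intro that[of "(1 / lam_sup - L - b - M) * (\<sigma> / 2)" 1]) auto
  qed
qed

lemma decseq_E: "decseq E"
proof (rule decseq_SucI)
  fix k
  obtain m e where "0 < m" "m * (d (k + e))\<^sup>2 \<le> E k - E (Suc k)"
    by (metis E_sufficient_decrease)
  then show "E (Suc k) \<le> E k" by (smt (verit) mult_nonneg_nonneg zero_le_power2)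
qed

lemma Psi_le_E: "f (x (Suc k)) + G k \<le> E k"
  unfolding E_def using M_nonneg D_nonneg by simp

lemma E_convergent: "convergent E"
proof -
  obtain c where c: "\<And>u. ereal c \<le> ereal (f u) + g u" using Psi_bdd by auto
  have "c \<le> E k" for k
    using c[of "x (Suc k)"] Psi_le_E[of k] by (simp add: g_x)
  then show ?thesis using decseq_convergent[OF decseq_E] unfolding convergent_def by metis
qed

lemma bounded_range: "bounded (range x)"
proof -
  have "ereal (f (x (Suc k))) + g (x (Suc k)) \<le> ereal (E 0)" for k
    using Psi_le_E[of k] decseqD[OF decseq_E, of 0 k] by (simp add: g_x)
  \<comment> \<open>\<open>x 0\<close> is added separately, since the objective may be infinite
    there.\<close>
  then have "x k \<in> insert (x 0) {u. ereal (f u) + g u \<le> ereal (E 0)}" for k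
    by (cases k) simp_all
  then have "range x \<subseteq> insert (x 0) {u. ereal (f u) + g u \<le> ereal (E 0)}" by blast
  then show ?thesis by (rule bounded_subset[rotated]) (simp add: Psi_sublevel)
qed

section \<open>Subgradients at the iterates and their size\<close>

definition Psi_sub :: "nat \<Rightarrow> 'a" where
  "Psi_sub k = gf (x (Suc k)) - (1 / lam k) *\<^sub>R (lin k + (gh (x (Suc k)) - gh (x k)))"

definition H_sub :: "nat \<Rightarrow> 'a \<times> 'a" where
  "H_sub k = (Psi_sub k + M *\<^sub>R (gh (x (Suc k)) - gh (x k)),
    - (M *\<^sub>R adjoint (frechet_derivative gh (at (x k))) (x (Suc k) - x k)))"

definition minor :: "nat \<Rightarrow> 'a \<Rightarrow> real" where
  "minor k u = f u + (G k - ((u - x (Suc k)) \<bullet> lin k + D u (x k) - D (x (Suc k)) (x k)) / lam k)"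

lemma minor_le: "ereal (minor k u) \<le> ereal (f u) + g u"
  unfolding minor_def plus_ereal.simps(1)[symmetric] by (intro add_left_mono prox_minorant)

lemma minor_eq: "ereal (f (x (Suc k))) + g (x (Suc k)) = ereal (minor k (x (Suc k)))"
  by (simp add: minor_def g_x)

text \<open>This is the origin of the formula for \<open>Psi_sub\<close>: the gradient of
  \<open>f\<close> plus that of the minorant in \<open>prox_minorant\<close>, both at the touching
  point.\<close>

lemma minor_deriv: "GDERIV (minor k) (x (Suc k)) :> Psi_sub k"
proof -
  have "(h has_derivative (\<lambda>d. d \<bullet> gh u)) (at u)" "(f has_derivative (\<lambda>d. d \<bullet> gf u)) (at u)" for u
    using h_deriv f_deriv by (simp_all add: gderiv_def)
  then show ?thesis
    unfolding gderiv_def minor_def breg_def Psi_sub_def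
    using lam_pos[of k]
    by (auto intro!: derivative_eq_intros simp: fun_eq_iff inner_simps inner_commute field_simps)
qed

lemma Psi_sub: "Psi_sub k \<in> frechet_subdiff (\<lambda>u. ereal (f u) + g u) (x (Suc k))"
  by (rule frechet_subdiff_minorant[OF minor_eq minor_le minor_deriv])

text \<open>The Bregman term is differentiable and enters \<open>Hr\<close> and the minorant
  identically. Hence the function touching the objective extends to one touching \<open>Hr\<close>
  on the product space.\<close>

lemma H_sub: "H_sub k \<in> frechet_subdiff Hr (x (Suc k), x k)"
proof (rule frechet_subdiff_minorant)
  let ?T = "\<lambda>z. minor k (fst z) + M * D (fst z) (snd z)"
  show "Hr (x (Suc k), x k) = ereal (?T (x (Suc k), x k))"
    by (simp add: Hr_def minor_eq)
  show "ereal (?T z) \<le> Hr z" for z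
    unfolding Hr_def plus_ereal.simps(1)[symmetric] by (intro add_right_mono minor_le)
  have "(minor k has_derivative (\<lambda>d. d \<bullet> Psi_sub k)) (at (fst (x (Suc k), x k)))"
    using minor_deriv by (simp add: gderiv_def)
  then have 1: "((\<lambda>z. minor k (fst z)) has_derivative (\<lambda>d. fst d \<bullet> Psi_sub k)) (at (x (Suc k), x k))"
    by (rule has_derivative_compose[OF has_derivative_fst[OF has_derivative_ident]])
  have "(gh has_derivative frechet_derivative gh (at (x k))) (at (x k))"
    using gh_diff by (simp add: frechet_derivative_works)
  from GDERIV_bregman[OF h_deriv this, of "x (Suc k)"]
  have 2: "((\<lambda>z. M * D (fst z) (snd z)) has_derivative (\<lambda>d. M * (d \<bullet> (gh (x (Suc k)) - gh (x k),
      - adjoint (frechet_derivative gh (at (x k))) (x (Suc k) - x k))))) (at (x (Suc k), x k))"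
    unfolding gderiv_def breg_def by (rule has_derivative_mult_right)
  show "GDERIV ?T (x (Suc k), x k) :> H_sub k"
    unfolding gderiv_def H_sub_def
    by (rule has_derivative_eq_rhs[OF has_derivative_add[OF 1 2]])
      (auto simp: inner_prod_def inner_simps algebra_simps)
qed

lemma Hr_iterate: "Hr (x (Suc k), x k) = ereal (E k)"
  by (simp add: Hr_def E_def g_x)

lemma subgradient_bounds:
  obtains C where "0 \<le> C" "\<And>k. norm (Psi_sub (Suc k)) \<le> C * (d (Suc k) + d k)"
    "\<And>k. norm (H_sub (Suc k)) \<le> C * (d (Suc k) + d k)"
proof -
  obtain Cf where Cf: "Cf-lipschitz_on (range x) gf" using gf_lipschitz[OF bounded_range] by auto
  obtain Ch where Ch: "Ch-lipschitz_on (range x) gh" using gh_lipschitz[OF bounded_range] by auto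
  obtain K where K: "\<And>k. onorm (frechet_derivative gh (at (x k))) \<le> K"
    using hessian_bounded[OF bounded_range] by auto
  have lin: "linear (frechet_derivative gh (at u))" for u
    using gh_diff by (rule linear_frechet_derivative)
  have nn: "0 \<le> Cf" "0 \<le> Ch" using Cf Ch by (auto dest: lipschitz_on_nonneg)
  have "0 \<le> onorm (frechet_derivative gh (at (x 0)))"
    using lin by (intro onorm_pos_le) (simp add: linear_conv_bounded_linear)
  then have "0 \<le> K" using K[of 0] by linarith
  have dn: "0 \<le> d k" for k by (simp add: d_def)
  have bs: "0 \<le> \<beta>_sup" using \<beta>_bounds[of 0] by linarith
  \<comment> \<open>\<open>C1\<close> collects the Lipschitz constants and the inertial factor for
    \<open>Psi_sub\<close>. In \<open>C\<close>, \<open>M * Ch\<close> accounts for the Bregman term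
    in the first component of \<open>H_sub\<close> and \<open>M * K\<close> for the Hessian in the
    second.\<close>
  define C1 where "C1 = Cf + \<beta>_sup / lam_inf + Ch / lam_inf"
  define C where "C = C1 + M * Ch + M * K"
  have "0 \<le> C1" using nn bs lam_inf_pos by (simp add: C1_def)
  then have "C1 \<le> C" using nn M_nonneg \<open>0 \<le> K\<close> by (simp add: C_def)
  have gh_le: "norm (gh (x (k + 2)) - gh (x (Suc k))) \<le> Ch * d (Suc k)" for k
    using lipschitz_onD[OF Ch, of "x (k + 2)" "x (Suc k)"] by (simp add: dist_norm d_def)
  have P: "norm (Psi_sub (Suc k)) \<le> C1 * (d (Suc k) + d k)" for k
  proof -
    let ?l = "lam (Suc k)" and ?\<beta> = "\<beta> (Suc k)"
    have lpos: "0 < ?l" by (rule lam_pos)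
    \<comment> \<open>Expanding \<open>lin (Suc k)\<close> leaves gradient differences and the
      inertial term. With the index \<open>Suc k\<close> the truncated predecessor in
      \<open>lin\<close> is \<open>k\<close>, which is where \<open>d k\<close> comes from.\<close>
    have "Psi_sub (Suc k) = (gf (x (k + 2)) - gf (x (Suc k)))
        + (?\<beta> / ?l) *\<^sub>R (x (Suc k) - x k) - (1 / ?l) *\<^sub>R (gh (x (k + 2)) - gh (x (Suc k)))"
      using lpos by (simp add: Psi_sub_def lin_def algebra_simps)
    then have "norm (Psi_sub (Suc k)) \<le> norm (gf (x (k + 2)) - gf (x (Suc k)))
        + norm ((?\<beta> / ?l) *\<^sub>R (x (Suc k) - x k))
        + norm ((1 / ?l) *\<^sub>R (gh (x (k + 2)) - gh (x (Suc k))))"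
      by (metis (no_types, lifting) add_right_mono norm_triangle_ineq norm_triangle_le_diff)
    also have "\<dots> \<le> Cf * d (Suc k) + \<beta>_sup / lam_inf * d k + 1 / lam_inf * (Ch * d (Suc k))"
    proof (intro add_mono)
      show "norm (gf (x (k + 2)) - gf (x (Suc k))) \<le> Cf * d (Suc k)"
        using lipschitz_onD[OF Cf, of "x (k + 2)" "x (Suc k)"] by (simp add: dist_norm d_def)
      have "?\<beta> / ?l * d k \<le> \<beta>_sup / lam_inf * d k"
        using \<beta>_bounds[of "Suc k"] lam_bounds(1)[of "Suc k"] lam_inf_pos dn
        by (intro mult_right_mono frac_le) auto
      then show "norm ((?\<beta> / ?l) *\<^sub>R (x (Suc k) - x k)) \<le> \<beta>_sup / lam_inf * d k"
        using \<beta>_bounds(1)[of "Suc k"] lpos by (simp add: d_def)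
      have "1 / ?l * norm (gh (x (k + 2)) - gh (x (Suc k))) \<le> 1 / lam_inf * (Ch * d (Suc k))"
        using lam_bounds(1)[of "Suc k"] lam_inf_pos
        by (intro mult_mono gh_le frac_le) auto
      then show "norm ((1 / ?l) *\<^sub>R (gh (x (k + 2)) - gh (x (Suc k)))) \<le> 1 / lam_inf * (Ch * d (Suc k))"
        using lpos by simp
    qed
    also have "\<dots> \<le> C1 * d (Suc k) + C1 * d k"
    proof -
      have "\<beta>_sup / lam_inf * d k \<le> C1 * d k"
        using nn bs lam_inf_pos dn by (intro mult_right_mono) (auto simp: C1_def)
      moreover have "(Cf + Ch / lam_inf) * d (Suc k) \<le> C1 * d (Suc k)"
        using nn bs lam_inf_pos dn by (intro mult_right_mono) (auto simp: C1_def)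
      ultimately show ?thesis by (simp add: algebra_simps)
    qed
    finally show ?thesis by (simp add: algebra_simps)
  qed
  have H: "norm (H_sub (Suc k)) \<le> C * (d (Suc k) + d k)" for k
  proof -
    let ?A = "frechet_derivative gh (at (x (Suc k)))"
    have "norm (adjoint ?A (x (k + 2) - x (Suc k))) \<le> onorm ?A * norm (x (k + 2) - x (Suc k))"
      by (rule norm_adjoint_le[OF lin])
    also have "\<dots> \<le> K * d (Suc k)" using K by (simp add: d_def mult_right_mono)
    finally have A: "norm (adjoint ?A (x (k + 2) - x (Suc k))) \<le> K * d (Suc k)" .
    have "norm (H_sub (Suc k)) \<le> norm (Psi_sub (Suc k) + M *\<^sub>R (gh (x (k + 2)) - gh (x (Suc k))))
        + norm (- (M *\<^sub>R adjoint ?A (x (k + 2) - x (Suc k))))"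
      unfolding H_sub_def by (rule order_trans[OF norm_Pair_le]) simp
    also have "\<dots> \<le> norm (Psi_sub (Suc k)) + M * norm (gh (x (k + 2)) - gh (x (Suc k)))
        + M * norm (adjoint ?A (x (k + 2) - x (Suc k)))"
      using M_nonneg by (auto intro: norm_triangle_le)
    also have "\<dots> \<le> C1 * (d (Suc k) + d k) + M * (Ch * d (Suc k)) + M * (K * d (Suc k))"
      using M_nonneg by (intro add_mono mult_left_mono P gh_le A)
    also have "\<dots> \<le> C1 * (d (Suc k) + d k) + (M * Ch + M * K) * (d (Suc k) + d k)"
      using mult_left_mono[of "d (Suc k)" "d (Suc k) + d k" "M * Ch + M * K"]
        M_nonneg nn \<open>0 \<le> K\<close> dn by (simp add: algebra_simps)
    finally show ?thesis by (simp add: C_def algebra_simps)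
  qed
  have "norm (Psi_sub (Suc k)) \<le> C * (d (Suc k) + d k)" for k
    using P[of k] \<open>C1 \<le> C\<close> dn by (smt (verit) mult_right_mono)
  then show ?thesis using that[of C] H \<open>0 \<le> C1\<close> \<open>C1 \<le> C\<close> by auto
qed

section \<open>Continuity and the limit of the energy\<close>

lemma f_tendsto:
  assumes "u \<longlonglongrightarrow> a"
  shows "(\<lambda>n. f (u n)) \<longlonglongrightarrow> f a"
proof -
  have "isCont f a" using f_deriv by (auto simp: gderiv_def intro: has_derivative_continuous)
  then show ?thesis using assms by (rule isCont_tendsto_compose)
qed

lemma D_tendsto:
  assumes u: "u \<longlonglongrightarrow> a" and w: "w \<longlonglongrightarrow> c"
  shows "(\<lambda>n. D (u n) (w n)) \<longlonglongrightarrow> D a c"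
proof -
  have "isCont h v" for v using h_deriv by (auto simp: gderiv_def intro: has_derivative_continuous)
  moreover have "isCont gh v" for v using gh_diff by (rule differentiable_imp_continuous_within)
  ultimately show ?thesis unfolding breg_def
    by (intro tendsto_intros isCont_tendsto_compose[where g = h] isCont_tendsto_compose[where g = gh] u w)
qed

text \<open>Lower semicontinuity gives only that the limit is at least \<open>f xt + gt\<close>. For
  the converse, \<open>prox_minorant\<close> is evaluated at \<open>xt\<close>: the touching points
  approach \<open>xt\<close>, so the correction terms vanish and \<open>G\<close> cannot stay above
  \<open>gt\<close> in the limit.\<close>

lemma E_limit:
  assumes r: "strict_mono r" and x1: "(\<lambda>j. x (r j)) \<longlonglongrightarrow> xt" and x0: "(\<lambda>j. x (r j - 1)) \<longlonglongrightarrow> xt"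
    and gt: "g xt = ereal gt"
  shows "E \<longlonglongrightarrow> f xt + gt"
proof -
  obtain E' where E': "E \<longlonglongrightarrow> E'" using E_convergent by (auto simp: convergent_def)
  \<comment> \<open>Dropping the first term of the subsequence makes \<open>r (Suc j)\<close>
    positive, so that subtracting 1 is genuine and \<open>Suc (s j) = r (Suc j)\<close>.\<close>
  define s where "s j = r (Suc j) - 1" for j
  have rpos: "0 < r (Suc j)" for j using r by (metis Suc_le_lessD seq_suble zero_less_Suc le_zero_eq not_gr0)
  then have Ss: "Suc (s j) = r (Suc j)" for j by (simp add: s_def)
  have "strict_mono s"
    using r rpos by (auto simp: strict_mono_Suc_iff s_def diff_less_mono Suc_leI)
  then have Es: "(\<lambda>j. E (s j)) \<longlonglongrightarrow> E'"
    using LIMSEQ_subseq_LIMSEQ[OF E'] by (simp add: comp_def)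
  have y: "(\<lambda>j. x (Suc (s j))) \<longlonglongrightarrow> xt" unfolding Ss using x1 by (rule LIMSEQ_Suc)
  have z: "(\<lambda>j. x (s j)) \<longlonglongrightarrow> xt" unfolding s_def using x0 by (rule LIMSEQ_Suc)
  obtain K where K: "\<And>k. norm (x k) \<le> K" using bounded_range by (auto simp: bounded_iff)
  have K0: "0 \<le> K" using K[of 0] norm_ge_zero order_trans by blast
  have bs: "0 \<le> \<beta>_sup" using \<beta>_bounds[of 0] by linarith
  \<comment> \<open>An upper bound of \<open>G (s j)\<close>. Since \<open>lam\<close> and
    \<open>\<beta>\<close> need not converge, they are replaced by their bounds, and
    \<open>2 * K\<close> bounds the inertial increment.\<close>
  define R where "R j = gt - (x (Suc (s j)) - xt) \<bullet> gf (x (s j))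
      + \<beta>_sup / lam_inf * (norm (x (Suc (s j)) - xt) * (2 * K))
      + \<bar>D xt (x (s j)) - D (x (Suc (s j))) (x (s j))\<bar> / lam_inf" for j
  have "(\<lambda>j. gf (x (s j))) \<longlonglongrightarrow> gf xt"
    using gf_cont z by (auto intro: continuous_on_tendsto_compose[where f = gf])
  then have "R \<longlonglongrightarrow> gt - (xt - xt) \<bullet> gf xt + \<beta>_sup / lam_inf * (norm (xt - xt) * (2 * K))
      + \<bar>D xt xt - D xt xt\<bar> / lam_inf"
    unfolding R_def using lam_inf_pos by (intro tendsto_intros D_tendsto y z) auto
  then have R: "R \<longlonglongrightarrow> gt" by simp
  have G_le: "G (s j) \<le> R j" for j
  proof -
    let ?k = "s j"
    let ?l = "lam ?k" and ?e = "x (Suc ?k) - xt" and ?\<Delta> = "x ?k - x (?k - 1)"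
    let ?B = "D xt (x ?k) - D (x (Suc ?k)) (x ?k)"
    have lpos: "0 < ?l" by (rule lam_pos)
    have "G ?k \<le> gt + ((xt - x (Suc ?k)) \<bullet> lin ?k + ?B) / ?l"
      using prox_minorant[of ?k xt] by (simp add: gt algebra_simps)
    also have "(xt - x (Suc ?k)) \<bullet> lin ?k = - (?l * (?e \<bullet> gf (x ?k))) + \<beta> ?k * (?e \<bullet> ?\<Delta>)"
      by (simp add: lin_def inner_simps algebra_simps)
    also have "(- (?l * (?e \<bullet> gf (x ?k))) + \<beta> ?k * (?e \<bullet> ?\<Delta>) + ?B) / ?l
        = - (?e \<bullet> gf (x ?k)) + \<beta> ?k / ?l * (?e \<bullet> ?\<Delta>) + ?B / ?l"
      using lpos by (simp add: add_divide_distrib diff_divide_distrib)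
    finally have "G ?k \<le> gt - ?e \<bullet> gf (x ?k) + \<beta> ?k / ?l * (?e \<bullet> ?\<Delta>) + ?B / ?l" by simp
    moreover have "\<beta> ?k / ?l * (?e \<bullet> ?\<Delta>) \<le> \<beta>_sup / lam_inf * (norm ?e * (2 * K))"
    proof -
      have "norm ?\<Delta> \<le> 2 * K"
        using norm_triangle_ineq4[of "x ?k" "x (?k - 1)"] K[of ?k] K[of "?k - 1"] by linarith
      then have "norm ?e * norm ?\<Delta> \<le> norm ?e * (2 * K)" by (rule mult_left_mono) simp
      then have "?e \<bullet> ?\<Delta> \<le> norm ?e * (2 * K)"
        using norm_cauchy_schwarz order_trans by blast
      then have "\<beta> ?k / ?l * (?e \<bullet> ?\<Delta>) \<le> \<beta> ?k / ?l * (norm ?e * (2 * K))"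
        using \<beta>_bounds(1)[of ?k] lpos by (intro mult_left_mono) auto
      also have "\<dots> \<le> \<beta>_sup / lam_inf * (norm ?e * (2 * K))"
        using \<beta>_bounds[of ?k] lam_bounds(1)[of ?k] lam_inf_pos bs K0
        by (intro mult_right_mono frac_le) auto
      finally show ?thesis .
    qed
    moreover have "?B / ?l \<le> \<bar>?B\<bar> / lam_inf"
      using lam_bounds(1)[of ?k] lam_inf_pos by (intro frac_le) auto
    ultimately show ?thesis unfolding R_def by linarith
  qed
  have fy: "(\<lambda>j. f (x (Suc (s j)))) \<longlonglongrightarrow> f xt" by (rule f_tendsto[OF y])
  have "E' \<le> f xt + gt"
  proof (rule LIMSEQ_le[OF Es])
    have "(\<lambda>j. f (x (Suc (s j))) + R j + M * D (x (Suc (s j))) (x (s j))) \<longlonglongrightarrow> f xt + gt + M * D xt xt"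
      by (intro tendsto_intros fy R D_tendsto y z)
    then show "(\<lambda>j. f (x (Suc (s j))) + R j + M * D (x (Suc (s j))) (x (s j))) \<longlonglongrightarrow> f xt + gt" by simp
    show "\<exists>N. \<forall>j\<ge>N. E (s j) \<le> f (x (Suc (s j))) + R j + M * D (x (Suc (s j))) (x (s j))"
      using G_le by (auto simp: E_def)
  qed
  moreover have "f xt + gt \<le> E'"
  proof (rule field_le_epsilon)
    fix \<epsilon> :: real assume "0 < \<epsilon>"
    then have "ereal (gt - \<epsilon>) < g xt" by (simp add: gt)
    then have "\<forall>\<^sub>F y in nhds xt. ereal (gt - \<epsilon>) < g y" by (rule lsc_eventually[OF g_lsc])
    then have "\<forall>\<^sub>F j in sequentially. ereal (gt - \<epsilon>) < g (x (Suc (s j)))"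
      using y by (rule eventually_compose_filterlim)
    then have "\<forall>\<^sub>F j in sequentially. f (x (Suc (s j))) + (gt - \<epsilon>) \<le> E (s j)"
    proof (rule eventually_mono)
      fix j assume "ereal (gt - \<epsilon>) < g (x (Suc (s j)))"
      then show "f (x (Suc (s j))) + (gt - \<epsilon>) \<le> E (s j)" using Psi_le_E[of "s j"] by (simp add: g_x)
    qed
    moreover have "(\<lambda>j. f (x (Suc (s j))) + (gt - \<epsilon>)) \<longlonglongrightarrow> f xt + (gt - \<epsilon>)"
      by (intro tendsto_intros fy)
    ultimately have "f xt + (gt - \<epsilon>) \<le> E'"
      using Es by (intro tendsto_le[OF sequentially_bot Es]) auto
    then show "f xt + gt \<le> E' + \<epsilon>" by simp
  qed
  ultimately show ?thesis using E' by simp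
qed

section \<open>Convergence of the iterates under the KL inequality\<close>

lemma KL_convergence:
  assumes lp: "limit_point_of (\<lambda>k. (x k, x (k - 1))) (xt, xt)" and KL: "KL_property_at Hr (xt, xt)"
  shows "summable d" "x \<longlonglongrightarrow> xt" "critical_point (\<lambda>u. ereal (f u) + g u) xt"
proof -
  obtain r where r: "strict_mono r" and rlim: "(\<lambda>j. (x (r j), x (r j - 1))) \<longlonglongrightarrow> (xt, xt)"
    using lp by (auto simp: limit_point_of_def comp_def)
  have x1: "(\<lambda>j. x (r j)) \<longlonglongrightarrow> xt" and x0: "(\<lambda>j. x (r j - 1)) \<longlonglongrightarrow> xt"
    using tendsto_fst[OF rlim] tendsto_snd[OF rlim] by simp_all
  from KL obtain \<eta> U \<psi> where ne: "limiting_subdiff Hr (xt, xt) \<noteq> {}"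
    and \<eta>: "0 < \<eta>" and U: "open U" "(xt, xt) \<in> U" and \<psi>: "KL_desingularizing \<eta> \<psi>"
    and KL': "\<And>z. z \<in> U \<Longrightarrow> Hr (xt, xt) < Hr z \<Longrightarrow> Hr z < Hr (xt, xt) + \<eta> \<Longrightarrow>
      1 \<le> ereal (deriv \<psi> (real_of_ereal (Hr z - Hr (xt, xt)))) * dist0 (limiting_subdiff Hr z)"
    unfolding KL_property_at_def by blast
  have "Hr (xt, xt) < \<infinity>" using ne by (auto simp: limiting_subdiff_def edom_def)
  then obtain gt where gt: "g xt = ereal gt"
    using g_proper by (cases "g xt") (auto simp: Hr_def proper_def)
  define E' where "E' = f xt + gt"
  have Hr_xt: "Hr (xt, xt) = ereal E'" by (simp add: Hr_def gt E'_def)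
  have E': "E \<longlonglongrightarrow> E'" unfolding E'_def by (rule E_limit[OF r x1 x0 gt])
  obtain \<rho> where \<rho>: "0 < \<rho>" "ball (xt, xt) \<rho> \<subseteq> U" using U by (meson open_contains_ball)
  obtain C where C: "0 \<le> C" "\<And>k. norm (Psi_sub (Suc k)) \<le> C * (d (Suc k) + d k)"
    "\<And>k. norm (H_sub (Suc k)) \<le> C * (d (Suc k) + d k)"
    using subgradient_bounds by blast
  obtain m e where me: "0 < m" "e \<le> (1::nat)" "\<And>k. m * (d (k + e))\<^sup>2 \<le> E k - E (Suc k)"
    using E_sufficient_decrease by blast
  show d: "summable d"
    unfolding d_def
  \<comment> \<open>The radius is halved because the norm of a pair is at most the sum of the norms
    of its components.\<close>
  proof (rule KL_finite_length[where E = E and m = m and e = e and C = C and \<rho> = "\<rho> / 2"])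
    fix k
    assume near: "norm (x (Suc k) - xt) < \<rho> / 2" "norm (x (k + 2) - xt) < \<rho> / 2"
      and gt: "E' < E (Suc k)" and lt: "ereal (E (Suc k) - E') < \<eta>"
    let ?z = "(x (Suc (Suc k)), x (Suc k))" and ?p = "deriv \<psi> (E (Suc k) - E')"
    have z: "Hr ?z = ereal (E (Suc k))" by (rule Hr_iterate)
    have "norm (x (Suc (Suc k)) - xt, x (Suc k) - xt) < \<rho>"
      using norm_Pair_le[of "x (Suc (Suc k)) - xt" "x (Suc k) - xt"] near by simp
    then have "dist ?z (xt, xt) < \<rho>" by (simp add: dist_norm)
    then have "?z \<in> U" using \<rho>(2) by (auto simp: dist_commute)
    moreover have "Hr ?z < Hr (xt, xt) + \<eta>"
      unfolding z Hr_xt using lt by (cases \<eta>) auto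
    ultimately have "1 \<le> ereal ?p * dist0 (limiting_subdiff Hr ?z)"
      using KL'[of ?z] gt by (simp add: z Hr_xt)
    also have "\<dots> \<le> ereal ?p * ereal (C * (d (Suc k) + d k))"
    proof (rule ereal_mult_left_mono)
      \<comment> \<open>Frechet subgradients are limiting subgradients, so
        \<open>H_sub (Suc k)\<close> competes in the infimum.\<close>
      have "dist0 (limiting_subdiff Hr ?z) \<le> ereal (norm (H_sub (Suc k)))"
        unfolding dist0_def
        using H_sub[of "Suc k"] frechet_subdiff_subset_limiting[of Hr ?z] by (intro INF_lower) auto
      also have "\<dots> \<le> ereal (C * (d (Suc k) + d k))" using C(3) by simp
      finally show "dist0 (limiting_subdiff Hr ?z) \<le> ereal (C * (d (Suc k) + d k))" .
      show "0 \<le> ereal ?p" using \<psi> gt lt by (simp add: KL_desingularizing_def less_imp_le)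
    qed
    finally have "1 \<le> ereal ?p * ereal (C * (d (Suc k) + d k))" .
    then show "1 \<le> ?p * (C * (norm (x (Suc (Suc k)) - x (Suc k)) + norm (x (Suc k) - x k)))"
      by (simp add: d_def one_ereal_def)
  qed (use C(1) me[unfolded d_def] \<rho>(1) \<eta> E' \<psi> r x1 in \<open>simp_all only: comp_def half_gt_zero\<close>)
  \<comment> \<open>Absolute summability gives convergence of the telescoping sum, and the given
    subsequence identifies the limit as \<open>xt\<close>.\<close>
  have "summable (\<lambda>k. x (Suc k) - x k)"
    using d unfolding d_def by (rule summable_norm_cancel)
  then have "convergent (\<lambda>n. (\<Sum>k<n. x (Suc k) - x k) + x 0)"
    unfolding summable_iff_convergent by (rule convergent_add[OF _ convergent_const])
  then obtain l where l: "x \<longlonglongrightarrow> l" by (auto simp: sum_lessThan_telescope convergent_def)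
  then have "(\<lambda>j. x (r j)) \<longlonglongrightarrow> l"
    using LIMSEQ_subseq_LIMSEQ[OF l r] by (simp add: comp_def)
  then have "l = xt" using x1 by (rule LIMSEQ_unique)
  then show xt: "x \<longlonglongrightarrow> xt" using l by simp
  have d0: "d \<longlonglongrightarrow> 0" by (rule summable_LIMSEQ_zero[OF d])
  have "(\<lambda>k. C * (d (Suc k) + d k)) \<longlonglongrightarrow> C * (0 + 0)"
    by (intro tendsto_intros LIMSEQ_Suc d0)
  then have "(\<lambda>k. C * (d (Suc k) + d k)) \<longlonglongrightarrow> 0" by simp
  moreover have "\<forall>\<^sub>F k in sequentially. norm (Psi_sub (Suc k)) \<le> C * (d (Suc k) + d k)"
    using C(2) by simp
  ultimately have "(\<lambda>k. Psi_sub (Suc k)) \<longlonglongrightarrow> 0"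
    by (rule Lim_null_comparison[rotated])
  moreover have "(\<lambda>k. x (Suc (Suc k))) \<longlonglongrightarrow> xt" by (intro LIMSEQ_Suc xt)
  \<comment> \<open>As \<open>g\<close> is only lower semicontinuous, convergence of the function
    values is read off from that of \<open>E\<close>, whose Bregman part tends to 0.\<close>
  moreover have "(\<lambda>k. ereal (f (x (Suc (Suc k)))) + g (x (Suc (Suc k)))) \<longlonglongrightarrow> ereal (f xt) + g xt"
  proof -
    have "(\<lambda>k. E (Suc k) - M * D (x (Suc (Suc k))) (x (Suc k))) \<longlonglongrightarrow> E' - M * D xt xt"
      by (intro tendsto_intros D_tendsto LIMSEQ_Suc xt E')
    then have "(\<lambda>k. f (x (Suc (Suc k))) + G (Suc k)) \<longlonglongrightarrow> E'" by (simp add: E_def)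
    then show ?thesis by (simp add: g_x gt E'_def)
  qed
  moreover have "xt \<in> edom (\<lambda>u. ereal (f u) + g u)" by (simp add: edom_def gt)
  ultimately show "critical_point (\<lambda>u. ereal (f u) + g u) xt"
    unfolding critical_point_def using Psi_sub by (intro limiting_subdiffI)
qed

end

section \<open>Reduction to the real valued setting\<close>

theorem theorem2:
  fixes f g h \<Psi> :: "'a::euclidean_space \<Rightarrow> ereal"
    and L \<sigma> M \<beta>_sup lam_sup lam_inf :: real
    and lam \<beta> :: "nat \<Rightarrow> real"
    and x :: "nat \<Rightarrow> 'a"
    and xt :: 'a
  assumes L_pos: "L > 0"
    and Psi_eq: "\<Psi> = (\<lambda>u. f u + g u)"
    and h_kernel: "kernel_generating_distance UNIV h"
    and f_not_minf: "\<And>u. f u \<noteq> -\<infinity>"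
    and f_C1: "C1_on f UNIV"
    and f_dom: "edom h \<subseteq> edom f"
    and f_smad: "smooth_adaptable L UNIV f h"
    and g_proper: "proper g"
    and g_lsc: "lsc g"
    and Psi_bdd: "(INF u. \<Psi> u) > -\<infinity>"
    and Psi_supercoercive: "supercoercive \<Psi>"
    and \<sigma>_pos: "\<sigma> > 0"
    and h_strong: "strongly_econvex \<sigma> h"
    and lam_range: "\<And>k. 0 < lam k \<and> lam k \<le> 1 / L"
    and \<beta>_range: "\<And>k. 0 \<le> \<beta> k \<and> \<beta> k < 1"
    and \<beta>_sup_eq: "\<beta>_sup = (SUP k. \<beta> k)"
    and lam_sup_eq: "lam_sup = (SUP k. lam k)"
    and lam_inf_eq: "lam_inf = (INF k. lam k)"
    and lam_inf_pos: "lam_inf > 0"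
    and gap: "\<beta>_sup / lam_inf * (1 / \<sigma>) < 1 / lam_sup - L - 1 / \<sigma> * (\<beta>_sup / lam_inf)"
    and M_lower: "\<beta>_sup / lam_inf * (1 / \<sigma>) \<le> M"
    and M_upper: "M \<le> 1 / lam_sup - L - 1 / \<sigma> * (\<beta>_sup / lam_inf)"
    and x_iBPG: "iBPG_sequence f g h lam \<beta> x"
    and grad_h_lipschitz: "\<And>B. bounded B \<Longrightarrow> \<exists>C. C-lipschitz_on B (grad h)"
    and grad_f_lipschitz: "\<And>B. bounded B \<Longrightarrow> \<exists>C. C-lipschitz_on B (grad f)"
    and hessian_h_exists: "\<And>u. grad h differentiable (at u)"
    and hessian_h_bounded: "\<And>B. bounded B \<Longrightarrow> \<exists>C. \<forall>u\<in>B. onorm (hessian h u) \<le> C"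
    and limit_point: "limit_point_of (\<lambda>k. (x k, x (k - 1))) (xt, xt)"
    and KL: "KL_property_at (H_fun \<Psi> h M) (xt, xt)"
  shows "summable (\<lambda>k. norm (x (Suc k) - x k)) \<and>
         (x \<longlonglongrightarrow> xt \<and> critical_point \<Psi> xt)"
proof -
  define fr where "fr = (\<lambda>u. real_of_ereal (f u))"
  define hr where "hr = (\<lambda>u. real_of_ereal (h u))"
  \<comment> \<open>The interior of the domain of \<open>h\<close> is the whole space, and that
    domain is contained in the domain of \<open>f\<close>.\<close>
  have "h u < \<infinity>" "h u \<noteq> -\<infinity>" "f u < \<infinity>" for u
    using h_kernel f_dom interior_subset[of "edom h"]
    by (auto simp: kernel_generating_distance_def proper_def edom_def)
  then have h: "h u = ereal (hr u)" and f: "f u = ereal (fr u)" for u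
    using f_not_minf[of u] unfolding hr_def fr_def by (cases "h u"; cases "f u"; auto)+
  have h_deriv: "GDERIV hr u :> grad h u" and f_deriv: "GDERIV fr u :> grad f u" for u
    using h_kernel f_C1 C1_on_GDERIV[of _ UNIV u]
    unfolding hr_def fr_def by (auto simp: kernel_generating_distance_def)
  have breg: "bregman h u w = ereal (breg hr (grad h) u w)" for u w
    by (simp add: bregman_def breg_def h)
  have Psi: "\<Psi> u = ereal (fr u) + g u" for u by (simp add: Psi_eq f)
  \<comment> \<open>Suprema and infima in the reals bound a sequence only once it is known to be
    bounded.\<close>
  have bdd_lam: "bdd_above (range lam)" "bdd_below (range lam)"
    using lam_range by (auto intro!: bdd_aboveI[of _ "1 / L"] bdd_belowI[of _ 0] simp: less_imp_le)
  have bdd_\<beta>: "bdd_above (range \<beta>)"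
    using \<beta>_range by (auto intro!: bdd_aboveI[of _ 1] simp: less_imp_le)
  interpret inertial_bregman fr hr g "grad f" "grad h" L \<sigma> lam_inf lam_sup \<beta>_sup M lam \<beta> x
    "\<beta>_sup / lam_inf / \<sigma>"
  proof unfold_locales
    show "fr u \<le> fr w + grad f w \<bullet> (u - w) + L * breg hr (grad h) u w" for u w
    proof -
      let ?\<phi> = "\<lambda>u. L * hr u - fr u"
      have conv: "convex_on UNIV ?\<phi>"
        using f_smad by (simp add: smooth_adaptable_def hr_def fr_def)
      have "GDERIV ?\<phi> w :> L *\<^sub>R grad h w - grad f w"
        using GDERIV_diff[OF GDERIV_mult[OF GDERIV_const h_deriv] f_deriv] by simp
      \<comment> \<open>The tangent inequality with modulus 0 for L h - f, which rearranges to the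
        descent inequality.\<close>
      then have "?\<phi> w + (L *\<^sub>R grad h w - grad f w) \<bullet> (u - w) + 0 / 2 * (norm (u - w))\<^sup>2 \<le> ?\<phi> u"
        using convex_onD[OF conv] by (intro strongly_convex_above_tangent) auto
      then show ?thesis by (simp add: breg_def inner_diff_left algebra_simps)
    qed
    show "\<sigma> / 2 * (norm (u - w))\<^sup>2 \<le> breg hr (grad h) u w" for u w
    proof -
      have "hr w + grad h w \<bullet> (u - w) + \<sigma> / 2 * (norm (u - w))\<^sup>2 \<le> hr u"
        using h_strong unfolding strongly_econvex_def
        by (intro strongly_convex_above_tangent h_deriv) (simp add: h)
      then show ?thesis by (simp add: breg_def)
    qed
    show "\<exists>c. \<forall>u. ereal c \<le> ereal (fr u) + g u"
    proof -
      obtain c where "-\<infinity> < ereal c" "ereal c < (INF u. \<Psi> u)" 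
        using ereal_dense2[OF Psi_bdd] by blast
      then show ?thesis by (metis INF_lower UNIV_I Psi less_imp_le order_trans)
    qed
    show "bounded {u. ereal (fr u) + g u \<le> ereal c}" for c
      using supercoercive_bounded_sublevel[OF Psi_supercoercive, of c] by (simp add: Psi)
    show "lam_inf \<le> lam k" "lam k \<le> lam_sup" "\<beta> k \<le> \<beta>_sup" for k
      using bdd_lam bdd_\<beta> by (auto simp: lam_inf_eq lam_sup_eq \<beta>_sup_eq intro: cINF_lower cSUP_upper)
    show "continuous_on UNIV (grad f)" using f_C1 by (simp add: C1_on_def)
    show "ereal (lam k) * g (x (Suc k)) + ereal (x (Suc k) \<bullet>
          (lam k *\<^sub>R grad f (x k) - \<beta> k *\<^sub>R (x k - x (k - 1))) + breg hr (grad h) (x (Suc k)) (x k))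
        \<le> ereal (lam k) * g u + ereal (u \<bullet>
          (lam k *\<^sub>R grad f (x k) - \<beta> k *\<^sub>R (x k - x (k - 1))) + breg hr (grad h) u (x k))" for k u
      using x_iBPG unfolding iBPG_sequence_def is_arg_min_def breg
      by (simp add: not_less add.assoc)
    show "\<exists>C. \<forall>u\<in>B. onorm (frechet_derivative (grad h) (at u)) \<le> C" if "bounded B" for B
      using hessian_h_bounded[OF that] by (simp add: hessian_def)
  qed (use h_deriv f_deriv \<sigma>_pos lam_inf_pos \<beta>_range gap M_lower M_upper g_proper g_lsc
      grad_h_lipschitz grad_f_lipschitz hessian_h_exists in \<open>simp_all add: field_simps\<close>)
  have "H_fun \<Psi> h M = Hr"
    by (auto simp: fun_eq_iff H_fun_def Hr_def Psi breg)
  moreover have "\<Psi> = (\<lambda>u. ereal (fr u) + g u)" by (simp add: fun_eq_iff Psi)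
  ultimately show ?thesis
    using KL_convergence[OF limit_point] KL by (simp add: d_def[abs_def])
qed

end
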